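(* Let $S\subseteq\mathbb{R}^m$ be any semi-algebraic set with $\dim(S)\ge2$. Then, for some $k\ge1$, there exists a polynomial map $\varphi\colon S\to\mathbb{R}^k$ such that the closed convex hull of $\varphi(S)$ in $\mathbb{R}^k$ has no semidefinite representation, i.e. is not a spectrahedral shadow.
   Context: A spectrahedron in $\mathbb{R}^N$ is a set of the form $\{\xi\in\mathbb{R}^N : M_0+\sum_{i=1}^N\xi_iM_i\succeq 0\}$ with $M_0,\dots,M_N$ real symmetric $d\times d$ matrices for some $d\ge1$ ($\succeq0$ means positive semidefinite). A set $K\subseteq\mathbb{R}^k$ is a spectrahedral shadow (equivalently, has a semidefinite representation) if $K=f(T)$ for some spectrahedron $T\subseteq\mathbb{R}^N$, some $N$, and some linear map $f\colon\mathbb{R}^N\to\mathbb{R}^k$. A polynomial map $S\to\mathbb{R}^k$ is the restriction to $S$ of a map $\mathbb{R}^m\to\mathbb{R}^k$ whose components are polynomials with real coefficients. $\dim(S)$ is the semi-algebraic dimension (the dimension of the Zariski closure of $S$). The closed convex hull is the euclidean closure of the convex hull. *)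

theory Defs
  imports
    "HOL-Analysis.Analysis"
    "HOL-Algebra.QuotRing"
    "HOL-Library.Function_Algebras"
    "HOL-Library.Extended_Nat"
begin

section \<open>Euclidean spaces of variable dimension\<close>

text \<open>
  The number of variables of a spectrahedron and the dimension of the target of a polynomial map
  are existentially quantified, so they cannot be type-level dimensions.  For these spaces,
  $\mathbb{R}^n$ is the set of all \<open>x :: nat \<Rightarrow> real\<close> with \<open>x i = 0\<close> for \<open>i \<ge> n\<close>, i.e. the underlying
  set of the library's topology \<open>Euclidean_space n\<close>.  It is a linear subspace of \<open>nat \<Rightarrow> real\<close>
  with the pointwise vector space structure, to which \<open>linear\<close> and \<open>convex hull\<close> refer.
\<close>

instantiation "fun" :: (type, real_vector) real_vector
begin

definition scaleR_fun_def: "scaleR c f = (\<lambda>x. c *\<^sub>R f x)"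

instance
  by standard (simp_all add: scaleR_fun_def fun_eq_iff scaleR_add_right scaleR_add_left)

end

abbreviation Rn :: "nat \<Rightarrow> (nat \<Rightarrow> real) set"
  where "Rn n \<equiv> topspace (Euclidean_space n)"


section \<open>Spectrahedra and their linear images\<close>

text \<open>
  A real \<open>d \<times> d\<close> matrix is a function \<open>nat \<Rightarrow> nat \<Rightarrow> real\<close> of which only the entries with both
  indices less than \<open>d\<close> are used.
\<close>

definition sym_matrix :: "nat \<Rightarrow> (nat \<Rightarrow> nat \<Rightarrow> real) \<Rightarrow> bool"
  where "sym_matrix d A \<longleftrightarrow> (\<forall>i<d. \<forall>j<d. A i j = A j i)"

definition psd_matrix :: "nat \<Rightarrow> (nat \<Rightarrow> nat \<Rightarrow> real) \<Rightarrow> bool"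
  where "psd_matrix d A \<longleftrightarrow>
    sym_matrix d A \<and> (\<forall>v :: nat \<Rightarrow> real. 0 \<le> (\<Sum>i<d. \<Sum>j<d. v i * A i j * v j))"

text \<open>The coefficient matrix of the (zero-based) \<open>l\<close>-th coordinate is \<open>M l\<close>.\<close>

definition spectrahedron :: "nat \<Rightarrow> (nat \<Rightarrow> real) set \<Rightarrow> bool"
  where "spectrahedron N T \<longleftrightarrow>
    (\<exists>d M0 M. 1 \<le> d \<and> sym_matrix d M0 \<and> (\<forall>l<N. sym_matrix d (M l)) \<and>
      T = {\<xi> \<in> Rn N. psd_matrix d (\<lambda>i j. M0 i j + (\<Sum>l<N. \<xi> l * M l i j))})"

text \<open>
  A linear map $\mathbb{R}^N \to \mathbb{R}^k$ is given by a linear map on the whole space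
  \<open>nat \<Rightarrow> real\<close> that maps $\mathbb{R}^N$ into $\mathbb{R}^k$.  There is no loss of generality:
  precompose with truncation to the first \<open>N\<close> coordinates.
\<close>

definition spectrahedral_shadow :: "nat \<Rightarrow> (nat \<Rightarrow> real) set \<Rightarrow> bool"
  where "spectrahedral_shadow k K \<longleftrightarrow>
    (\<exists>N T f. spectrahedron N T \<and> linear f \<and> f ` Rn N \<subseteq> Rn k \<and> K = f ` T)"


section \<open>Semi-algebraic sets and their dimension\<close>

text \<open>
  On \<open>real ^ 'm\<close> the library's predicate \<open>real_polynomial_function\<close>, the closure of the linear forms
  and constants under sums and products, describes the functions given by polynomials with real
  coefficients in the coordinates.
\<close>

inductive semialgebraic :: "(real ^ 'm) set \<Rightarrow> bool"
  where
    pos: "real_polynomial_function f \<Longrightarrow> semialgebraic {x. f x > 0}"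
  | compl: "semialgebraic A \<Longrightarrow> semialgebraic (- A)"
  | union: "semialgebraic A \<Longrightarrow> semialgebraic B \<Longrightarrow> semialgebraic (A \<union> B)"

text \<open>
  Since the field of real numbers is infinite, this ring of functions is isomorphic to the
  polynomial ring over the reals in \<open>CARD('m)\<close> variables.
\<close>

definition polynomial_ring :: "(real ^ 'm \<Rightarrow> real) ring"
  where "polynomial_ring =
    \<lparr>carrier = Collect real_polynomial_function,
     mult = (\<lambda>f g x. f x * g x), one = (\<lambda>x. 1),
     zero = (\<lambda>x. 0), add = (\<lambda>f g x. f x + g x)\<rparr>"

definition vanishing_ideal :: "(real ^ 'm) set \<Rightarrow> (real ^ 'm \<Rightarrow> real) set"
  where "vanishing_ideal V = {f. real_polynomial_function f \<and> (\<forall>x\<in>V. f x = 0)}"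

definition zariski_closure :: "(real ^ 'm) set \<Rightarrow> (real ^ 'm) set"
  where "zariski_closure S = {x. \<forall>f\<in>vanishing_ideal S. f x = 0}"

definition coordinate_ring :: "(real ^ 'm) set \<Rightarrow> (real ^ 'm \<Rightarrow> real) set ring"
  where "coordinate_ring V = polynomial_ring Quot vanishing_ideal V"

text \<open>
  The zero ring, which has no prime ideals, gets Krull dimension 0 here.
\<close>

definition krull_dim :: "('a, 'b) ring_scheme \<Rightarrow> enat"
  where "krull_dim R =
    (SUP n \<in> {n. \<exists>P. (\<forall>i\<le>n. primeideal (P i) R) \<and> (\<forall>i<n. P i \<subset> P (Suc i))}. enat n)"

definition semialg_dim :: "(real ^ 'm) set \<Rightarrow> enat"
  where "semialg_dim S = krull_dim (coordinate_ring (zariski_closure S))"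

lemma cring_polynomial_ring: "cring (polynomial_ring :: (real ^ 'm \<Rightarrow> real) ring)"
proof (rule cringI)
  have "\<exists>g\<in>Collect real_polynomial_function. (\<lambda>x. g x + f x) = (\<lambda>x. 0)"
    if "real_polynomial_function f" for f :: "real ^ 'm \<Rightarrow> real"
    using that by (intro bexI[of _ "\<lambda>x. - f x"]) (auto intro: real_polynomial_function_minus)
  then show "abelian_group (polynomial_ring :: (real ^ 'm \<Rightarrow> real) ring)"
    by (intro abelian_groupI) (auto simp: polynomial_ring_def algebra_simps)
  show "comm_monoid (polynomial_ring :: (real ^ 'm \<Rightarrow> real) ring)"
    by (intro comm_monoidI) (auto simp: polynomial_ring_def algebra_simps)
qed (auto simp: polynomial_ring_def algebra_simps)

lemma ideal_vanishing_ideal: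
  fixes V :: "(real ^ 'm) set"
  shows "ideal (vanishing_ideal V) polynomial_ring"
proof -
  interpret cring polynomial_ring by (rule cring_polynomial_ring)
  have inv: "\<ominus>\<^bsub>polynomial_ring\<^esub> f = (\<lambda>x. - f x)" if "real_polynomial_function f"
    for f :: "real ^ 'm \<Rightarrow> real"
    using that
    by (intro minus_equality) (auto simp: polynomial_ring_def intro: real_polynomial_function_minus)
  show ?thesis
  proof (rule idealI)
    show "subgroup (vanishing_ideal V) (add_monoid polynomial_ring)"
      by (rule add.subgroupI)
        (use inv in \<open>auto simp: vanishing_ideal_def polynomial_ring_def a_inv_def
          intro: real_polynomial_function_minus\<close>)
  qed (auto simp: vanishing_ideal_def polynomial_ring_def ring_axioms[unfolded polynomial_ring_def])
qed


section \<open>Polynomial maps\<close>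

definition polynomial_map_on :: "(real ^ 'm) set \<Rightarrow> nat \<Rightarrow> (real ^ 'm \<Rightarrow> nat \<Rightarrow> real) \<Rightarrow> bool"
  where "polynomial_map_on S k \<phi> \<longleftrightarrow>
    (\<exists>g. (\<forall>x. g x \<in> Rn k) \<and> (\<forall>i<k. real_polynomial_function (\<lambda>x. g x i)) \<and>
      (\<forall>x\<in>S. \<phi> x = g x))"

end

theory Submission
  imports Defs
begin

text \<open>
  Since \<open>dim S \<ge> 2\<close>, there are polynomials \<open>a, b\<close> without any algebraic relation on \<open>S\<close>.  Let
  \<open>\<phi>\<close> consist of the monomials \<open>a\<^sup>i b\<^sup>j\<close> with \<open>i, j \<le> 6\<close>, and suppose that the closed convex hull
  \<open>K\<close> of \<open>\<phi>(S)\<close> is the image \<open>f(T)\<close> of a spectrahedron \<open>T = {M(\<xi>) \<succeq> 0}\<close>.  The semi-algebraic set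
  \<open>X\<close> of all \<open>(x, \<xi>, Z)\<close> with \<open>x \<in> S\<close>, \<open>f(\<xi>) = \<phi>(x)\<close> and \<open>M(\<xi>) = Z Z\<^sup>T\<close> maps onto \<open>S\<close>.  Along an
  ultrafilter on \<open>X\<close> that avoids all curves in the \<open>(a, b)\<close>-plane, one coordinate of \<open>X\<close> after the
  other is either free or given by a separable algebraic equation over the previous ones.  Hence
  some point of \<open>X\<close> lies on a local section of \<open>(a, b) : X \<rightarrow> \<real>\<^sup>2\<close> that has a third-order Taylor
  expansion there.

  Nine points of a small grid around this point carry a signed measure that is negative on a
  scaled copy of Robinson's nonnegative sextic but nonnegative on squares of cubics; an error term
  of higher order makes it nonnegative on the squares of all linear combinations of the entries of
  \<open>Z\<close>.  Therefore the corresponding affine combination of the points \<open>\<xi>\<close> still lies in \<open>T\<close>,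
  although a linear functional that is nonnegative on \<open>K\<close> is negative at its image.
\<close>


section \<open>Ultrafilters\<close>

lemma eventually_INF_principal:
  "eventually P (INF A\<in>M. principal A) \<longleftrightarrow> (\<exists>X\<subseteq>M. finite X \<and> (\<forall>x\<in>\<Inter>X. P x))"
proof -
  have *: "eventually P (INF A\<in>X. principal A) \<longleftrightarrow> (\<forall>x\<in>\<Inter>X. P x)" if "finite X" for X
    by (subst INF_principal_finite[OF that]) (simp only: eventually_principal image_ident)
  show ?thesis
  proof (subst eventually_INF, intro iffI; elim exE conjE)
    fix X assume "X \<subseteq> M" "finite X" "eventually P (INF A\<in>X. principal A)"
    then show "\<exists>X\<subseteq>M. finite X \<and> (\<forall>x\<in>\<Inter>X. P x)" using *[of X] by (intro exI[of _ X]) simp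
  next
    fix X assume "X \<subseteq> M" "finite X" "\<forall>x\<in>\<Inter>X. P x"
    then show "\<exists>X\<subseteq>M. finite X \<and> eventually P (INF A\<in>X. principal A)"
      using *[of X] by (intro exI[of _ X]) simp
  qed
qed

text \<open>Zorn's lemma yields a family \<open>M\<close> that is maximal among those containing
  \<open>\<A>\<close> with the finite intersection property. The filter it generates is proper, and
  maximality makes it decide every predicate.\<close>

lemma ultrafilter_extension:
  assumes fip: "\<And>X. finite X \<Longrightarrow> X \<subseteq> \<A> \<Longrightarrow> \<Inter>X \<noteq> {}"
  obtains U :: "'a filter" where "U \<noteq> bot" "\<And>A. A \<in> \<A> \<Longrightarrow> \<forall>\<^sub>F x in U. x \<in> A"
    "\<And>P. (\<forall>\<^sub>F x in U. P x) \<or> (\<forall>\<^sub>F x in U. \<not> P x)"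
proof -
  define \<F> where "\<F> = {\<C>. \<A> \<subseteq> \<C> \<and> (\<forall>X. finite X \<longrightarrow> X \<subseteq> \<C> \<longrightarrow> \<Inter>X \<noteq> {})}"
  have "\<exists>M\<in>\<F>. \<forall>X\<in>\<F>. M \<subseteq> X \<longrightarrow> X = M"
  proof (rule subset_Zorn_nonempty)
    show "\<F> \<noteq> {}" using fip by (auto simp: \<F>_def)
    fix \<C> assume ne: "\<C> \<noteq> {}" and chain: "subset.chain \<F> \<C>"
    then have sub: "\<C> \<subseteq> \<F>" by (simp add: subset_chain_def)
    have "\<Inter>X \<noteq> {}" if X: "finite X" "X \<subseteq> \<Union>\<C>" for X
    proof -
      obtain Y where "Y \<in> \<C>" "X \<subseteq> Y"
        using finite_subset_Union_chain[OF X ne chain] by blast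
      then show ?thesis using sub X(1) by (auto simp: \<F>_def)
    qed
    moreover have "\<A> \<subseteq> \<Union>\<C>" using ne sub by (auto simp: \<F>_def)
    ultimately show "\<Union>\<C> \<in> \<F>" by (simp add: \<F>_def)
  qed
  then obtain M where M: "M \<in> \<F>" and max: "\<And>X. X \<in> \<F> \<Longrightarrow> M \<subseteq> X \<Longrightarrow> X = M"
    by blast
  have M_sub: "\<A> \<subseteq> M" and M_fip: "finite X \<Longrightarrow> X \<subseteq> M \<Longrightarrow> \<Inter>X \<noteq> {}" for X
    using M by (simp_all add: \<F>_def)
  define U where "U = (INF A\<in>M. principal A)"
  have ev: "eventually P U \<longleftrightarrow> (\<exists>X\<subseteq>M. finite X \<and> (\<forall>x\<in>\<Inter>X. P x))" for P
    unfolding U_def by (rule eventually_INF_principal)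
  show ?thesis
  proof
    show "U \<noteq> bot"
    proof
      assume "U = bot"
      then obtain X where "X \<subseteq> M" "finite X" "\<forall>x\<in>\<Inter>X. False"
        using ev[of "\<lambda>_. False"] by simp blast
      then show False using M_fip[of X] by blast
    qed
    show "\<forall>\<^sub>F x in U. x \<in> A" if "A \<in> \<A>" for A
    proof -
      have "A \<in> M" using that M_sub by blast
      then show ?thesis unfolding ev by (intro exI[of _ "{A}"]) simp
    qed
    show "(\<forall>\<^sub>F x in U. P x) \<or> (\<forall>\<^sub>F x in U. \<not> P x)" for P
    proof (cases "Collect P \<in> M")
      case True
      then have "\<exists>X\<subseteq>M. finite X \<and> (\<forall>x\<in>\<Inter>X. P x)" by (intro exI[of _ "{Collect P}"]) simp
      then show ?thesis unfolding ev[of P] by (rule disjI1)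
    next
      case False
      \<comment> \<open>By maximality \<open>Collect P\<close> cannot be added to \<open>M\<close>,
        so some finite intersection of members of \<open>M\<close> already avoids it.\<close>
      then have "insert (Collect P) M \<notin> \<F>" using max[of "insert (Collect P) M"] by blast
      then obtain X where X: "finite X" "X \<subseteq> insert (Collect P) M" "\<Inter>X = {}"
        using M_sub by (auto simp only: \<F>_def mem_Collect_eq)
      have "X - {Collect P} \<subseteq> M" "finite (X - {Collect P})" using X(1,2) by auto
      moreover have "\<forall>x\<in>\<Inter>(X - {Collect P}). \<not> P x" using X(3) by blast
      ultimately have "\<forall>\<^sub>F x in U. \<not> P x" unfolding ev by blast
      then show ?thesis ..
    qed
  qed
qed

section \<open>Polynomial functions of finitely many variables\<close>

text \<open>Polynomials are kept as functions on all valuations, with \<open>I\<close> naming the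
  variables that may occur. Thus the set of variables can grow one by one within a fixed
  type.\<close>

inductive_set mpoly_fun :: "'i set \<Rightarrow> (('i \<Rightarrow> real) \<Rightarrow> real) set" for I
  where
    const: "(\<lambda>v. c) \<in> mpoly_fun I"
  | var: "i \<in> I \<Longrightarrow> (\<lambda>v. v i) \<in> mpoly_fun I"
  | add: "f \<in> mpoly_fun I \<Longrightarrow> g \<in> mpoly_fun I \<Longrightarrow> (\<lambda>v. f v + g v) \<in> mpoly_fun I"
  | mult: "f \<in> mpoly_fun I \<Longrightarrow> g \<in> mpoly_fun I \<Longrightarrow> (\<lambda>v. f v * g v) \<in> mpoly_fun I"

lemma mpoly_fun_diff:
  assumes "f \<in> mpoly_fun I" "g \<in> mpoly_fun I"
  shows "(\<lambda>v. f v - g v) \<in> mpoly_fun I"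
  using mpoly_fun.add[OF assms(1) mpoly_fun.mult[OF mpoly_fun.const[of "-1"] assms(2)]] by simp

lemma mpoly_fun_if:
  "(P \<Longrightarrow> f \<in> mpoly_fun I) \<Longrightarrow> (\<lambda>v. if P then f v else 0) \<in> mpoly_fun I"
  by (cases P) (auto intro: mpoly_fun.const)

lemma mpoly_fun_sum:
  assumes "\<And>k. k \<in> K \<Longrightarrow> f k \<in> mpoly_fun I"
  shows "(\<lambda>v. \<Sum>k\<in>K. f k v) \<in> mpoly_fun I"
  using assms
  by (induction K rule: infinite_finite_induct) (auto intro: mpoly_fun.intros)

lemma mpoly_fun_power: "f \<in> mpoly_fun I \<Longrightarrow> (\<lambda>v. f v ^ n) \<in> mpoly_fun I"
  by (induction n) (auto intro: mpoly_fun.intros)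

lemma mpoly_fun_mono: "f \<in> mpoly_fun I \<Longrightarrow> I \<subseteq> J \<Longrightarrow> f \<in> mpoly_fun J"
  by (induction rule: mpoly_fun.induct) (auto intro: mpoly_fun.intros)

lemma mpoly_fun_cong:
  "f \<in> mpoly_fun I \<Longrightarrow> (\<And>i. i \<in> I \<Longrightarrow> v i = w i) \<Longrightarrow> f v = f w"
  by (induction rule: mpoly_fun.induct) auto

lemma mpoly_fun_prod_expand:
  assumes "\<And>i. i \<le> d \<Longrightarrow> c i \<in> mpoly_fun I" "\<And>i. i \<le> e \<Longrightarrow> b i \<in> mpoly_fun I"
  obtains a where "\<And>i. i \<le> d + e \<Longrightarrow> a i \<in> mpoly_fun I"
    "\<And>v x. (\<Sum>i\<le>d. c i v * x ^ i) * (\<Sum>i\<le>e. b i v * x ^ i) = (\<Sum>i\<le>d+e. a i v * x ^ i)"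
proof
  \<comment> \<open>Coefficients beyond \<open>d\<close> and \<open>e\<close> are arbitrary
    functions, so they are cut to 0 before the Cauchy product is formed.\<close>
  let ?c = "\<lambda>i v. if i \<le> d then c i v else 0" and ?b = "\<lambda>i v. if i \<le> e then b i v else 0"
  let ?a = "\<lambda>k v. \<Sum>i\<le>k. ?c i v * ?b (k - i) v"
  show "?a i \<in> mpoly_fun I" if "i \<le> d + e" for i
    by (intro mpoly_fun_sum mpoly_fun.mult mpoly_fun_if) (auto intro: assms)
  show "(\<Sum>i\<le>d. c i v * x ^ i) * (\<Sum>i\<le>e. b i v * x ^ i) = (\<Sum>i\<le>d+e. ?a i v * x ^ i)" for v x
  proof -
    have "(\<Sum>i\<le>d. c i v * x ^ i) * (\<Sum>i\<le>e. b i v * x ^ i)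
        = (\<Sum>i\<le>d. ?c i v * x ^ i) * (\<Sum>i\<le>e. ?b i v * x ^ i)"
      by simp
    also have "\<dots> = (\<Sum>i\<le>d+e. ?a i v * x ^ i)"
      by (subst polynomial_product[of d "\<lambda>i. ?c i v" e "\<lambda>i. ?b i v"]) auto
    finally show ?thesis .
  qed
qed

lemma mpoly_fun_insert_expand:
  assumes "f \<in> mpoly_fun (insert j I)"
  shows "\<exists>d c. (\<forall>i\<le>d. c i \<in> mpoly_fun I) \<and> (\<forall>v. f v = (\<Sum>i\<le>d. c i v * v j ^ i))"
  using assms
proof (induction rule: mpoly_fun.induct)
  case (const c)
  then show ?case
    by (intro exI[of _ 0] exI[of _ "\<lambda>_ _. c"]) (auto intro: mpoly_fun.intros)
next
  case (var i)
  show ?case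
  proof (cases "i = j")
    case True
    then show ?thesis
      by (intro exI[of _ 1] exI[of _ "\<lambda>k _. if k = 1 then 1 else 0"])
        (auto intro: mpoly_fun.intros)
  next
    case False
    then show ?thesis using var
      by (intro exI[of _ 0] exI[of _ "\<lambda>_ v. v i"]) (auto intro: mpoly_fun.intros)
  qed
next
  case (add f g)
  then obtain d c e b where c: "\<forall>i\<le>d. c i \<in> mpoly_fun I" "\<And>v. f v = (\<Sum>i\<le>d. c i v * v j ^ i)"
    and b: "\<forall>i\<le>e. b i \<in> mpoly_fun I" "\<And>v. g v = (\<Sum>i\<le>e. b i v * v j ^ i)"
    by blast
  let ?c = "\<lambda>i v. if i \<le> d then c i v else 0" and ?b = "\<lambda>i v. if i \<le> e then b i v else 0"
  have "f v = (\<Sum>i\<le>d+e. ?c i v * v j ^ i)" for v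
    unfolding c by (intro sum.mono_neutral_cong_left) auto
  moreover have "g v = (\<Sum>i\<le>d+e. ?b i v * v j ^ i)" for v
    unfolding b by (intro sum.mono_neutral_cong_left) auto
  ultimately have "f v + g v = (\<Sum>i\<le>d+e. (?c i v + ?b i v) * v j ^ i)" for v
    by (simp add: sum.distrib distrib_right)
  moreover have "\<forall>i\<le>d+e. (\<lambda>v. ?c i v + ?b i v) \<in> mpoly_fun I"
    using c b by (intro allI impI mpoly_fun.add mpoly_fun_if) auto
  ultimately show ?case
    by (intro exI[of _ "d + e"] exI[of _ "\<lambda>i v. ?c i v + ?b i v"]) blast
next
  case (mult f g)
  then obtain d c e b where c: "\<forall>i\<le>d. c i \<in> mpoly_fun I" "\<And>v. f v = (\<Sum>i\<le>d. c i v * v j ^ i)"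
    and b: "\<forall>i\<le>e. b i \<in> mpoly_fun I" "\<And>v. g v = (\<Sum>i\<le>e. b i v * v j ^ i)"
    by blast
  obtain a where a: "\<And>i. i \<le> d + e \<Longrightarrow> a i \<in> mpoly_fun I"
    "\<And>v x. (\<Sum>i\<le>d. c i v * x ^ i) * (\<Sum>i\<le>e. b i v * x ^ i) = (\<Sum>i\<le>d+e. a i v * x ^ i)"
    by (rule mpoly_fun_prod_expand[of d c I e b]) (use c(1) b(1) in auto)
  have "f v * g v = (\<Sum>i\<le>d+e. a i v * v j ^ i)" for v
    by (simp only: c(2)[of v] b(2)[of v] a(2))
  then show ?case using a(1) by blast
qed

lemma mpoly_fun_line:
  assumes "f \<in> mpoly_fun I"
  shows "\<exists>p. \<forall>t. f (\<lambda>i. v i + t * w i) = poly p t"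
  using assms
proof (induction rule: mpoly_fun.induct)
  case (const c)
  then show ?case by (intro exI[of _ "[:c:]"]) simp
next
  case (var i)
  then show ?case by (intro exI[of _ "[:v i, w i:]"]) simp
next
  case (add f g)
  then obtain p q where "\<forall>t. f (\<lambda>i. v i + t * w i) = poly p t"
    "\<forall>t. g (\<lambda>i. v i + t * w i) = poly q t" by blast
  then show ?case by (intro exI[of _ "p + q"]) simp
next
  case (mult f g)
  then obtain p q where "\<forall>t. f (\<lambda>i. v i + t * w i) = poly p t"
    "\<forall>t. g (\<lambda>i. v i + t * w i) = poly q t" by blast
  then show ?case by (intro exI[of _ "p * q"]) simp
qed

text \<open>On the line joining a point where one factor is nonzero to a point where the other is,
  both restrict to nonzero univariate polynomials, whose product is nonzero. This supplies the
  finite intersection property for complements of curves.\<close>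

lemma mpoly_fun_prod_nonzero:
  assumes "finite Q" "Q \<subseteq> mpoly_fun I" "\<And>q. q \<in> Q \<Longrightarrow> \<exists>v. q v \<noteq> 0"
  shows "\<exists>f\<in>mpoly_fun I. (\<exists>v. f v \<noteq> 0) \<and> (\<forall>v. f v = (\<Prod>q\<in>Q. q v))"
  using assms
proof (induction Q rule: finite_induct)
  case empty
  then show ?case by (intro bexI[of _ "\<lambda>v. 1"]) (auto intro: mpoly_fun.const)
next
  case (insert q Q)
  then have "\<exists>f\<in>mpoly_fun I. (\<exists>v. f v \<noteq> 0) \<and> (\<forall>v. f v = (\<Prod>q\<in>Q. q v))"
    by (intro insert.IH) blast+
  then obtain f v where f: "f \<in> mpoly_fun I" "f v \<noteq> 0" "\<And>v. f v = (\<Prod>q\<in>Q. q v)"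
    by blast
  obtain w where w: "q w \<noteq> 0" using insert.prems(2)[of q] by auto
  from insert have q: "q \<in> mpoly_fun I" by auto
  obtain p1 where p1: "\<And>t. f (\<lambda>i. v i + t * (w i - v i)) = poly p1 t"
    using mpoly_fun_line[OF f(1)] by metis
  obtain p2 where p2: "\<And>t. q (\<lambda>i. v i + t * (w i - v i)) = poly p2 t"
    using mpoly_fun_line[OF q] by metis
  have "poly p1 0 \<noteq> 0" "poly p2 1 \<noteq> 0" using p1[of 0] p2[of 1] f(2) w by auto
  then have "p1 * p2 \<noteq> 0" by auto
  then obtain t where "poly (p1 * p2) t \<noteq> 0" using poly_all_0_iff_0 by blast
  then have "q (\<lambda>i. v i + t * (w i - v i)) * f (\<lambda>i. v i + t * (w i - v i)) \<noteq> 0"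
    using p1 p2 by simp
  then have "\<exists>v. q v * f v \<noteq> 0" by blast
  moreover have "q v * f v = (\<Prod>q\<in>insert q Q. q v)" for v
    using insert.hyps f(3) by simp
  ultimately show ?case by (intro bexI[OF _ mpoly_fun.mult[OF q f(1)]]) simp
qed

section \<open>Third-order jets at the origin of the plane\<close>

text \<open>Lipschitz at the origin only: the roots chosen below are not known to be continuous
  anywhere else.\<close>

definition lip0 :: "(real \<times> real \<Rightarrow> real) set"
  where "lip0 = {u. (\<lambda>h. u h - u 0) \<in> O[nhds 0](norm)}"

lemma tendsto_norm_nhds_0: "((norm :: real \<times> real \<Rightarrow> real) \<longlongrightarrow> 0) (nhds 0)"
  using tendsto_norm[OF filterlim_ident, of "0 :: real \<times> real"] by simp

lemma norm_smallo_1: "(norm :: real \<times> real \<Rightarrow> real) \<in> o[nhds 0](\<lambda>_. 1)"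
  by (intro smalloI_tendsto) (simp_all add: tendsto_norm_nhds_0)

lemma norm_power_bigo: "m \<le> n \<Longrightarrow> (\<lambda>h :: real \<times> real. norm h ^ n) \<in> O[nhds 0](\<lambda>h. norm h ^ m)"
proof -
  assume "m \<le> n"
  have "\<forall>\<^sub>F h :: real \<times> real in nhds 0. norm h < 1"
    using order_tendstoD(2)[OF tendsto_norm_nhds_0, of 1] by simp
  then have "\<forall>\<^sub>F h :: real \<times> real in nhds 0. norm (norm h ^ n) \<le> 1 * norm (norm h ^ m)"
    by eventually_elim (use \<open>m \<le> n\<close> in \<open>auto intro: power_decreasing\<close>)
  then show ?thesis by (rule bigoI)
qed

lemma lip0_tendsto: "u \<in> lip0 \<Longrightarrow> (u \<longlongrightarrow> u 0) (nhds 0)"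
  using smalloD_tendsto[OF landau_o.big_small_trans[OF _ norm_smallo_1], of "\<lambda>h. u h - u 0"]
  by (simp add: lip0_def LIM_zero_iff)

lemma lip0_bounded: "u \<in> lip0 \<Longrightarrow> u \<in> O[nhds 0](\<lambda>_. 1)"
proof -
  assume "u \<in> lip0"
  then have "(\<lambda>h. u h - u 0) \<in> O[nhds 0](\<lambda>_. 1)"
    unfolding lip0_def using landau_o.big.trans landau_o.small_imp_big[OF norm_smallo_1] by blast
  from sum_in_bigo(1)[OF this, of "\<lambda>_. u 0"] show ?thesis by simp
qed

lemma lip0_const: "(\<lambda>_. c) \<in> lip0"
  by (simp add: lip0_def)

lemma lip0_add: "u \<in> lip0 \<Longrightarrow> v \<in> lip0 \<Longrightarrow> (\<lambda>h. u h + v h) \<in> lip0"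
  using sum_in_bigo(1)[of "\<lambda>h. u h - u 0" "nhds 0" norm "\<lambda>h. v h - v 0"]
  by (simp add: lip0_def algebra_simps)

lemma lip0_mult: assumes "u \<in> lip0" "v \<in> lip0" shows "(\<lambda>h. u h * v h) \<in> lip0"
proof -
  have "(\<lambda>h. (u h - u 0) * v h) \<in> O[nhds 0](\<lambda>h. norm h * 1)"
    using assms lip0_bounded by (intro landau_o.big.mult) (auto simp: lip0_def)
  moreover have "(\<lambda>h. u 0 * (v h - v 0)) \<in> O[nhds 0](\<lambda>h. 1 * norm h)"
    using assms by (intro landau_o.big.mult) (auto simp: lip0_def)
  ultimately have "(\<lambda>h. (u h - u 0) * v h + u 0 * (v h - v 0)) \<in> O[nhds 0](norm)"
    by (intro sum_in_bigo(1)) simp_all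
  then show ?thesis by (simp add: lip0_def algebra_simps)
qed

lemma lip0_sum: "(\<And>i. i \<in> A \<Longrightarrow> f i \<in> lip0) \<Longrightarrow> (\<lambda>h. \<Sum>i\<in>A. f i h) \<in> lip0"
  by (induction A rule: infinite_finite_induct) (auto intro: lip0_const lip0_add)

lemma lip0_power: "u \<in> lip0 \<Longrightarrow> (\<lambda>h. u h ^ n) \<in> lip0"
  by (induction n) (auto intro: lip0_const lip0_mult)

lemma lip0_fst: "fst \<in> lip0" and lip0_snd: "snd \<in> lip0"
proof -
  have "\<bar>fst h\<bar> \<le> norm h" "\<bar>snd h\<bar> \<le> norm h" for h :: "real \<times> real"
    using norm_fst_le[of "fst h" "snd h"] norm_snd_le[of "snd h" "fst h"] by simp_all
  then show "fst \<in> lip0" "snd \<in> lip0"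
    by (auto simp: lip0_def intro!: bigoI[of _ 1] always_eventually)
qed

definition bipoly :: "real poly poly \<Rightarrow> real \<times> real \<Rightarrow> real"
  where "bipoly p h = poly (poly p [:fst h:]) (snd h)"

lemma bipoly_expand:
  "bipoly p h = (\<Sum>i\<le>degree p. \<Sum>j\<le>degree (coeff p i). coeff (coeff p i) j * (fst h ^ i * snd h ^ j))"
proof -
  have "bipoly p h = (\<Sum>i\<le>degree p. poly (coeff p i) (snd h) * fst h ^ i)"
    by (simp add: bipoly_def poly_altdef[of p] poly_sum poly_power)
  then show ?thesis
    by (simp add: poly_altdef sum_distrib_left sum_distrib_right mult_ac)
qed

lemma bipoly_lip0: "bipoly p \<in> lip0"
  unfolding bipoly_expand[abs_def]
  by (intro lip0_sum lip0_mult lip0_const lip0_power lip0_fst lip0_snd)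

text \<open>A third-order Taylor expansion with remainder of order four. \<open>p\<close> may have
  any degree, as its terms of degree at least four are absorbed by the remainder. Since
  \<open>nhds 0\<close> includes the origin, \<open>u\<close> and \<open>p\<close> agree
  there.\<close>

definition jet :: "(real \<times> real \<Rightarrow> real) set"
  where "jet = {u. \<exists>p. (\<lambda>h. u h - bipoly p h) \<in> O[nhds 0](\<lambda>h. norm h ^ 4)}"

lemma jetE:
  assumes "u \<in> jet"
  obtains p where "(\<lambda>h. u h - bipoly p h) \<in> O[nhds 0](\<lambda>h. norm h ^ 4)" "u 0 = bipoly p 0"
proof -
  obtain p where p: "(\<lambda>h. u h - bipoly p h) \<in> O[nhds 0](\<lambda>h. norm h ^ 4)"
    using assms by (auto simp: jet_def)
  then obtain c where "\<forall>\<^sub>F h in nhds 0. norm (u h - bipoly p h) \<le> c * norm (norm h ^ 4)"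
    by (auto elim: landau_o.bigE)
  from eventually_nhds_x_imp_x[OF this] have "u 0 = bipoly p 0" by simp
  with p show ?thesis by (rule that)
qed

lemma jet_lip0: assumes "u \<in> jet" shows "u \<in> lip0"
proof -
  obtain p where p: "(\<lambda>h. u h - bipoly p h) \<in> O[nhds 0](\<lambda>h. norm h ^ 4)" "u 0 = bipoly p 0"
    using assms by (rule jetE)
  have "(\<lambda>h. u h - bipoly p h) \<in> O[nhds 0](norm)"
    using landau_o.big.trans[OF p(1) norm_power_bigo[of 1 4]] by simp
  moreover have "(\<lambda>h. bipoly p h - bipoly p 0) \<in> O[nhds 0](norm)"
    using bipoly_lip0 by (simp add: lip0_def)
  ultimately show ?thesis
    using sum_in_bigo(1)[of "\<lambda>h. u h - bipoly p h" "nhds 0" norm "\<lambda>h. bipoly p h - bipoly p 0"]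
    by (simp add: lip0_def p(2))
qed

lemma jet_bipoly: "bipoly p \<in> jet"
  unfolding jet_def by (intro CollectI exI[of _ p]) simp

lemma jet_const: "(\<lambda>_. c) \<in> jet"
  using jet_bipoly[of "[:[:c:]:]"] by (simp add: bipoly_def[abs_def])

lemma jet_fst: "fst \<in> jet"
  using jet_bipoly[of "[:0, 1:]"] by (simp add: bipoly_def[abs_def])

lemma jet_snd: "snd \<in> jet"
  using jet_bipoly[of "[:[:0, 1:]:]"] by (simp add: bipoly_def[abs_def])

lemma jet_add: assumes "u \<in> jet" "v \<in> jet" shows "(\<lambda>h. u h + v h) \<in> jet"
proof -
  obtain p where p: "(\<lambda>h. u h - bipoly p h) \<in> O[nhds 0](\<lambda>h. norm h ^ 4)"
    using assms(1) by (rule jetE)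
  obtain q where q: "(\<lambda>h. v h - bipoly q h) \<in> O[nhds 0](\<lambda>h. norm h ^ 4)"
    using assms(2) by (rule jetE)
  have "(\<lambda>h. u h + v h - bipoly (p + q) h) \<in> O[nhds 0](\<lambda>h. norm h ^ 4)"
    using sum_in_bigo(1)[OF p q] by (simp add: bipoly_def algebra_simps)
  then show ?thesis by (auto simp: jet_def)
qed

lemma jet_mult: assumes "u \<in> jet" "v \<in> jet" shows "(\<lambda>h. u h * v h) \<in> jet"
proof -
  obtain p where p: "(\<lambda>h. u h - bipoly p h) \<in> O[nhds 0](\<lambda>h. norm h ^ 4)"
    using assms(1) by (rule jetE)
  obtain q where q: "(\<lambda>h. v h - bipoly q h) \<in> O[nhds 0](\<lambda>h. norm h ^ 4)"
    using assms(2) by (rule jetE)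
  have "(\<lambda>h. (u h - bipoly p h) * v h) \<in> O[nhds 0](\<lambda>h. norm h ^ 4 * 1)"
    by (intro landau_o.big.mult p lip0_bounded jet_lip0 assms)
  moreover have "(\<lambda>h. bipoly p h * (v h - bipoly q h)) \<in> O[nhds 0](\<lambda>h. 1 * norm h ^ 4)"
    by (intro landau_o.big.mult q lip0_bounded bipoly_lip0)
  ultimately have "(\<lambda>h. (u h - bipoly p h) * v h + bipoly p h * (v h - bipoly q h))
      \<in> O[nhds 0](\<lambda>h. norm h ^ 4)"
    by (intro sum_in_bigo(1)) simp_all
  then have "(\<lambda>h. u h * v h - bipoly (p * q) h) \<in> O[nhds 0](\<lambda>h. norm h ^ 4)"
    by (simp add: bipoly_def algebra_simps)
  then show ?thesis by (auto simp: jet_def)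
qed

lemma jet_cong_bigo:
  assumes "v \<in> jet" "(\<lambda>h. u h - v h) \<in> O[nhds 0](\<lambda>h. norm h ^ 4)"
  shows "u \<in> jet"
proof -
  obtain q where q: "(\<lambda>h. v h - bipoly q h) \<in> O[nhds 0](\<lambda>h. norm h ^ 4)"
    using assms(1) by (rule jetE)
  from sum_in_bigo(1)[OF assms(2) q] show ?thesis by (auto simp: jet_def)
qed

lemma jet_sum: "(\<And>i. i \<in> A \<Longrightarrow> f i \<in> jet) \<Longrightarrow> (\<lambda>h. \<Sum>i\<in>A. f i h) \<in> jet"
  by (induction A rule: infinite_finite_induct) (auto intro: jet_const jet_add)

lemma jet_power: "u \<in> jet \<Longrightarrow> (\<lambda>h. u h ^ n) \<in> jet"
  by (induction n) (auto intro: jet_const jet_mult)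

text \<open>For each \<open>h\<close> near 0 the intermediate value theorem gives a root near
  \<open>y0\<close>, since the divided difference stays close to the nonzero derivative. Choosing a
  root for each \<open>h\<close> gives no regularity off the origin, but the bound by
  \<open>\<bar>q h y0\<bar>\<close> makes the choice Lipschitz at the origin. The inner sum over
  \<open>k\<close> is the derivative of \<open>x ^ i\<close> at \<open>y0\<close>.\<close>

lemma implicit_lip0:
  fixes c :: "nat \<Rightarrow> real \<times> real \<Rightarrow> real"
  assumes c: "\<And>i. i \<le> d \<Longrightarrow> c i \<in> lip0"
    and root: "(\<Sum>i\<le>d. c i 0 * y0 ^ i) = 0"
    and D: "(\<Sum>i\<le>d. c i 0 * (\<Sum>k<i. y0 ^ (i - Suc k) * y0 ^ k)) \<noteq> 0"
  obtains y where "y \<in> lip0" "y 0 = y0" "\<forall>\<^sub>F h in nhds 0. (\<Sum>i\<le>d. c i h * y h ^ i) = 0"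
proof -
  define q where "q h x = (\<Sum>i\<le>d. c i h * x ^ i)" for h x
  \<comment> \<open>\<open>Q h x\<close> is the divided difference of \<open>q h\<close> between
    \<open>y0\<close> and \<open>x\<close>, so \<open>D\<close> is the derivative of
    \<open>q 0\<close> at \<open>y0\<close>.\<close>
  define Q where "Q h x = (\<Sum>i\<le>d. c i h * (\<Sum>k<i. y0 ^ (i - Suc k) * x ^ k))" for h x
  define D where "D = Q 0 y0"
  have "D \<noteq> 0" using D by (simp add: D_def Q_def)
  have qQ: "q h x = q h y0 + (x - y0) * Q h x" for h x
  proof -
    have "c i h * x ^ i = c i h * y0 ^ i + (x - y0) * (c i h * (\<Sum>k<i. y0 ^ (i - Suc k) * x ^ k))" for i
      using arg_cong[OF power_diff_sumr2[of x i y0], of "\<lambda>z. c i h * z"] by (simp add: algebra_simps)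
    then have "q h x = (\<Sum>i\<le>d. c i h * y0 ^ i + (x - y0) * (c i h * (\<Sum>k<i. y0 ^ (i - Suc k) * x ^ k)))"
      by (simp add: q_def)
    then show ?thesis by (simp add: sum.distrib q_def Q_def sum_distrib_left)
  qed
  have "((\<lambda>(h, x). Q h x / D) \<longlongrightarrow> Q 0 y0 / D) (nhds 0 \<times>\<^sub>F nhds y0)"
    unfolding Q_def case_prod_unfold using \<open>D \<noteq> 0\<close>
    by (intro tendsto_intros filterlim_compose[OF lip0_tendsto[OF c] filterlim_fst]
        filterlim_snd) auto
  then have "((\<lambda>(h, x). Q h x / D) \<longlongrightarrow> 1) (nhds 0 \<times>\<^sub>F nhds y0)"
    using \<open>D \<noteq> 0\<close> by (simp add: D_def)
  then have "\<forall>\<^sub>F (h, x) in nhds 0 \<times>\<^sub>F nhds y0. Q h x / D > 1/2"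
    using order_tendstoD(1)[of _ 1 _ "1/2"] by (force simp: case_prod_unfold)
  then obtain P1 P2 where P: "eventually P1 (nhds 0)" "eventually P2 (nhds y0)"
    "\<And>h x. P1 h \<Longrightarrow> P2 x \<Longrightarrow> Q h x / D > 1/2"
    by (auto simp: eventually_prod_filter)
  obtain r where r: "r > 0" "\<And>x. \<bar>x - y0\<bar> \<le> r \<Longrightarrow> P2 x"
  proof -
    obtain e where e: "e > 0" "\<And>x. dist x y0 < e \<Longrightarrow> P2 x"
      using P(2) by (auto simp: eventually_nhds_metric)
    show ?thesis by (rule that[of "e/2"]) (use e in \<open>auto simp: dist_real_def\<close>)
  qed
  have q0_lip: "(\<lambda>h. q h y0) \<in> lip0"
    unfolding q_def by (intro lip0_sum lip0_mult c lip0_const) auto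
  have q00: "q 0 y0 = 0" using root by (simp add: q_def)
  have "((\<lambda>h. \<bar>q h y0 / D\<bar>) \<longlongrightarrow> \<bar>0 / D\<bar>) (nhds 0)"
    using lip0_tendsto[OF q0_lip] q00 \<open>D \<noteq> 0\<close> by (intro tendsto_intros) auto
  \<comment> \<open>At \<open>y0 + r\<close> and \<open>y0 - r\<close> the term
    \<open>(x - y0) * (Q h x / D)\<close> has size at least \<open>r/2\<close>; a constant term
    below \<open>r/4\<close> cannot spoil its sign.\<close>
  then have "\<forall>\<^sub>F h in nhds 0. \<bar>q h y0 / D\<bar> < r/4"
    using r(1) by (intro order_tendstoD(2)) auto
  with P(1) have ex: "\<forall>\<^sub>F h in nhds 0. \<exists>x. \<bar>x - y0\<bar> \<le> 2 / \<bar>D\<bar> * \<bar>q h y0\<bar> \<and> q h x = 0"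
  proof eventually_elim
    case (elim h)
    define g where "g x = q h x / D" for x
    have gQ: "g x = q h y0 / D + (x - y0) * (Q h x / D)" for x
      unfolding g_def by (subst qQ) (simp add: add_divide_distrib)
    have half: "Q h x / D > 1/2" if "\<bar>x - y0\<bar> \<le> r" for x
      using P(3)[OF elim(1) r(2)] that by auto
    have small: "- (r/4) < q h y0 / D" "q h y0 / D < r/4"
      using elim(2) unfolding abs_less_iff by linarith+
    have "r * (Q h (y0 + r) / D) \<ge> r * (1/2)"
      using half[of "y0 + r"] r(1) by (intro mult_left_mono) auto
    moreover have "g (y0 + r) = q h y0 / D + r * (Q h (y0 + r) / D)"
      unfolding gQ by simp
    ultimately have pos: "g (y0 + r) \<ge> 0" using small r(1) by linarith
    have "r * (Q h (y0 - r) / D) \<ge> r * (1/2)"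
      using half[of "y0 - r"] r(1) by (intro mult_left_mono) auto
    moreover have "g (y0 - r) = q h y0 / D - r * (Q h (y0 - r) / D)"
      unfolding gQ by simp
    ultimately have neg: "g (y0 - r) \<le> 0" using small r(1) by linarith
    have "continuous_on {y0 - r..y0 + r} g"
      unfolding g_def q_def using \<open>D \<noteq> 0\<close> by (intro continuous_intros) auto
    then obtain x where x: "y0 - r \<le> x" "x \<le> y0 + r" "g x = 0"
      using IVT'[of g "y0 - r" 0 "y0 + r"] pos neg r(1) by auto
    have x_r: "\<bar>x - y0\<bar> \<le> r" using x by linarith
    have "\<bar>x - y0\<bar> * (1/2) \<le> \<bar>x - y0\<bar> * (Q h x / D)"
      using half[OF x_r] by (intro mult_left_mono) linarith+
    also have "\<dots> = \<bar>(x - y0) * (Q h x / D)\<bar>"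
      using half[OF x_r] by (simp only: abs_mult)
    also have "(x - y0) * (Q h x / D) = - (q h y0 / D)" using gQ[of x] x(3) by simp
    finally have "\<bar>x - y0\<bar> \<le> 2 / \<bar>D\<bar> * \<bar>q h y0\<bar>" by (simp add: field_simps)
    moreover have "q h x = 0" using x(3) \<open>D \<noteq> 0\<close> by (simp add: g_def)
    ultimately show ?case by blast
  qed
  define y where "y h = (SOME x. \<bar>x - y0\<bar> \<le> 2 / \<bar>D\<bar> * \<bar>q h y0\<bar> \<and> q h x = 0)" for h
  have y: "\<forall>\<^sub>F h in nhds 0. \<bar>y h - y0\<bar> \<le> 2 / \<bar>D\<bar> * \<bar>q h y0\<bar> \<and> q h (y h) = 0"
    using ex unfolding y_def by eventually_elim (rule someI_ex)
  \<comment> \<open>At the origin the bound is 0, which forces the chosen root to be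
    \<open>y0\<close>.\<close>
  have y_0: "y 0 = y0" using eventually_nhds_x_imp_x[OF y] q00 by simp
  have "(\<lambda>h. y h - y0) \<in> O[nhds 0](\<lambda>h. q h y0)"
    using y by (intro bigoI[of _ "2 / \<bar>D\<bar>"]) (auto elim: eventually_mono)
  also have "(\<lambda>h. q h y0) \<in> O[nhds 0](norm)" using q0_lip q00 by (simp add: lip0_def)
  finally have "y \<in> lip0" using y_0 by (simp add: lip0_def)
  moreover have "\<forall>\<^sub>F h in nhds 0. (\<Sum>i\<le>d. c i h * y h ^ i) = 0"
    using y unfolding q_def by (auto elim: eventually_mono)
  ultimately show ?thesis using y_0 that by blast
qed

text \<open>
  The simplified Newton iteration, whose derivative is frozen at the origin, gains one order per
  step; the implicit function thus inherits a jet although it is not known to be differentiable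
  anywhere but at the origin.
\<close>

lemma implicit_jet:
  fixes c :: "nat \<Rightarrow> real \<times> real \<Rightarrow> real"
  assumes c: "\<And>i. i \<le> d \<Longrightarrow> c i \<in> jet"
    and root: "(\<Sum>i\<le>d. c i 0 * y0 ^ i) = 0"
    and D: "(\<Sum>i\<le>d. c i 0 * (\<Sum>k<i. y0 ^ (i - Suc k) * y0 ^ k)) \<noteq> 0"
  obtains y where "y \<in> jet" "y 0 = y0" "\<forall>\<^sub>F h in nhds 0. (\<Sum>i\<le>d. c i h * y h ^ i) = 0"
proof -
  obtain y where y: "y \<in> lip0" "y 0 = y0" "\<forall>\<^sub>F h in nhds 0. (\<Sum>i\<le>d. c i h * y h ^ i) = 0"
    using implicit_lip0[OF jet_lip0[OF c] root D] by blast
  define D where "D = (\<Sum>i\<le>d. c i 0 * (\<Sum>k<i. y0 ^ (i - Suc k) * y0 ^ k))"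
  have "D \<noteq> 0" using D by (simp add: D_def)
  \<comment> \<open>The approximation \<open>w\<close> has an error of order \<open>n + 1\<close>;
    the case \<open>n = 3\<close> gives the remainder of a jet.\<close>
  have "\<exists>w\<in>jet. w 0 = y0 \<and> (\<lambda>h. y h - w h) \<in> O[nhds 0](\<lambda>h. norm h ^ Suc n)" for n
  proof (induction n)
    case 0
    show ?case using y jet_const[of y0] by (intro bexI[of _ "\<lambda>_. y0"]) (auto simp: lip0_def)
  next
    case (Suc n)
    then obtain w where w: "w \<in> jet" "w 0 = y0" "(\<lambda>h. y h - w h) \<in> O[nhds 0](\<lambda>h. norm h ^ Suc n)"
      by blast
    define w' where "w' h = w h + (-1 / D) * (\<Sum>i\<le>d. c i h * w h ^ i)" for h
    \<comment> \<open>The Newton step turns the error \<open>y - w\<close> into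
      \<open>(y - w) * E\<close>. At the origin the sum in \<open>E\<close> is the derivative
      \<open>D\<close>, so \<open>E\<close> vanishes there and contributes one further
      order.\<close>
    define E where "E h = 1 + (-1 / D) * (\<Sum>i\<le>d. c i h * (\<Sum>k<i. w h ^ (i - Suc k) * y h ^ k))" for h
    have "w' \<in> jet"
      unfolding w'_def by (intro jet_add jet_mult jet_sum jet_const jet_power w c) auto
    moreover have "w' 0 = y0" using root w by (simp add: w'_def)
    moreover have "(\<lambda>h. y h - w' h) \<in> O[nhds 0](\<lambda>h. norm h ^ Suc (Suc n))"
    proof -
      have "E \<in> lip0"
        unfolding E_def
        by (intro lip0_add lip0_mult lip0_sum lip0_const lip0_power y jet_lip0 w c) auto
      moreover have "E 0 = 0" using y w \<open>D \<noteq> 0\<close> by (simp add: E_def D_def)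
      ultimately have "E \<in> O[nhds 0](norm)" by (simp add: lip0_def)
      then have "(\<lambda>h. (y h - w h) * E h) \<in> O[nhds 0](\<lambda>h. norm h ^ Suc n * norm h)"
        by (intro landau_o.big.mult w)
      moreover have "\<forall>\<^sub>F h in nhds 0. y h - w' h = (y h - w h) * E h"
        using y(3)
      proof eventually_elim
        case (elim h)
        have "c i h * y h ^ i - c i h * w h ^ i
            = (y h - w h) * (c i h * (\<Sum>k<i. w h ^ (i - Suc k) * y h ^ k))" for i
          using arg_cong[OF power_diff_sumr2[of "y h" i "w h"], of "\<lambda>z. c i h * z"] by (simp add: algebra_simps)
        then have "(\<Sum>i\<le>d. c i h * y h ^ i) - (\<Sum>i\<le>d. c i h * w h ^ i)
            = (y h - w h) * (\<Sum>i\<le>d. c i h * (\<Sum>k<i. w h ^ (i - Suc k) * y h ^ k))"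
          by (simp add: sum_subtractf[symmetric] sum_distrib_left)
        then have *: "(\<Sum>i\<le>d. c i h * w h ^ i)
            = - ((y h - w h) * (\<Sum>i\<le>d. c i h * (\<Sum>k<i. w h ^ (i - Suc k) * y h ^ k)))"
          using elim by simp
        show ?case unfolding w'_def E_def * by (simp add: algebra_simps diff_divide_distrib)
      qed
      ultimately show ?thesis
        by (subst landau_o.big.in_cong[where g = "\<lambda>h. (y h - w h) * E h"]) (simp_all add: mult_ac)
    qed
    ultimately show ?case by blast
  qed
  from this[of 3] obtain w where "w \<in> jet" "(\<lambda>h. y h - w h) \<in> O[nhds 0](\<lambda>h. norm h ^ 4)"
    by auto
  then have "y \<in> jet" by (rule jet_cong_bigo)
  with y that show ?thesis by blast
qed

section \<open>Sections through generic points\<close>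

text \<open>
  The polynomial functions that vanish eventually along an ultrafilter form a prime ideal; its
  residue ring plays the role of the coordinate ring of an irreducible variety, but finitely many
  of its equations and inequations can always be met by an actual point.
\<close>

definition alg_rel ::
    "('i \<Rightarrow> real) filter \<Rightarrow> 'i set \<Rightarrow> 'i \<Rightarrow> nat \<Rightarrow> (nat \<Rightarrow> ('i \<Rightarrow> real) \<Rightarrow> real) \<Rightarrow> bool"
  where "alg_rel U J j d c \<longleftrightarrow> (\<forall>i\<le>d. c i \<in> mpoly_fun J) \<and>
    (\<forall>\<^sub>F v in U. (\<Sum>i\<le>d. c i v * v j ^ i) = 0) \<and> \<not> (\<forall>\<^sub>F v in U. c d v = 0)"

lemma coeffs_vanish:
  assumes "\<And>d c. d \<le> e \<Longrightarrow> \<not> alg_rel U J j d c"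
    and "\<And>i. i \<le> e \<Longrightarrow> c i \<in> mpoly_fun J"
    and "\<forall>\<^sub>F v in U. (\<Sum>i\<le>e. c i v * v j ^ i) = 0"
  shows "i \<le> e \<Longrightarrow> \<forall>\<^sub>F v in U. c i v = 0"
  using assms
proof (induction e)
  case 0
  then show ?case by simp
next
  case (Suc e)
  have top: "\<forall>\<^sub>F v in U. c (Suc e) v = 0"
    using Suc.prems(2)[of "Suc e" c] Suc.prems(3,4) by (auto simp: alg_rel_def)
  with Suc.prems(4) have "\<forall>\<^sub>F v in U. (\<Sum>i\<le>e. c i v * v j ^ i) = 0"
    by eventually_elim simp
  then show ?case
    using Suc.IH Suc.prems(1-3) top by (cases "i = Suc e") (auto simp: le_Suc_eq)
qed

text \<open>Division by a relation \<open>P\<close> of least degree leaves a remainder of degree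
  below \<open>d\<close> that vanishes along \<open>U\<close>, so by minimality all its coefficients
  do. They form \<open>E\<close>: wherever they vanish and \<open>P d\<close> does not, the equation
  follows from \<open>P\<close> alone.\<close>

lemma pseudo_division:
  assumes P: "alg_rel U J j d P" and min: "\<And>d' c. d' < d \<Longrightarrow> \<not> alg_rel U J j d' c"
    and "\<And>i. i \<le> e \<Longrightarrow> c i \<in> mpoly_fun J"
    and "\<forall>\<^sub>F v in U. (\<Sum>i\<le>e. c i v * v j ^ i) = 0"
  shows "\<exists>E. finite E \<and> E \<subseteq> mpoly_fun J \<and> (\<forall>g\<in>E. \<forall>\<^sub>F v in U. g v = 0) \<and>
    (\<forall>v x. (\<forall>g\<in>E. g v = 0) \<longrightarrow> (\<Sum>i\<le>d. P i v * x ^ i) = 0 \<longrightarrow> P d v \<noteq> 0 \<longrightarrow>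
      (\<Sum>i\<le>e. c i v * x ^ i) = 0)"
  using assms(3,4)
proof (induction e arbitrary: c rule: less_induct)
  case (less e)
  have "d \<noteq> 0"
  proof
    assume "d = 0"
    then show False using P by (simp add: alg_rel_def)
  qed
  show ?case
  proof (cases "e < d")
    case True
    then have "\<forall>\<^sub>F v in U. c i v = 0" if "i \<le> e" for i
      using coeffs_vanish[of e U J j c i] min less.prems that by auto
    then show ?thesis using less.prems by (intro exI[of _ "c ` {..e}"]) auto
  next
    case False
    define m where "m = e - d"
    have e: "e = m + d" using False by (simp add: m_def)
    have "e \<noteq> 0" using False \<open>d \<noteq> 0\<close> by simp
    \<comment> \<open>These are the coefficients of \<open>P d * c - c e * x ^ m * P\<close>; the
      terms of degree \<open>e\<close> cancel, which leaves degree at most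
      \<open>e - 1\<close>.\<close>
    define c' where "c' i v = P d v * c i v - (if m \<le> i then c e v * P (i - m) v else 0)" for i v
    have id: "(\<Sum>i\<le>e-1. c' i v * x ^ i)
        = P d v * (\<Sum>i\<le>e. c i v * x ^ i) - c e v * x ^ m * (\<Sum>i\<le>d. P i v * x ^ i)" for v x
    proof -
      have "(\<Sum>i\<le>e. (if m \<le> i then c e v * P (i - m) v else 0) * x ^ i)
          = (\<Sum>i\<in>{0+m..d+m}. c e v * P (i - m) v * x ^ i)"
        by (rule sum.mono_neutral_cong_right) (auto simp: e)
      also have "\<dots> = c e v * x ^ m * (\<Sum>i\<le>d. P i v * x ^ i)"
        by (subst sum.shift_bounds_cl_nat_ivl)
          (simp add: power_add sum_distrib_left mult_ac atLeast0AtMost)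
      finally have "(\<Sum>i\<le>e. c' i v * x ^ i)
          = P d v * (\<Sum>i\<le>e. c i v * x ^ i) - c e v * x ^ m * (\<Sum>i\<le>d. P i v * x ^ i)"
        by (simp add: c'_def left_diff_distrib right_diff_distrib sum_subtractf sum_distrib_left mult_ac)
      moreover have "c' e v = 0" by (simp add: c'_def e)
      moreover have "(\<Sum>i\<le>e. c' i v * x ^ i) = (\<Sum>i\<le>e-1. c' i v * x ^ i) + c' e v * x ^ e"
        using \<open>e \<noteq> 0\<close> by (cases e) simp_all
      ultimately show ?thesis by simp
    qed
    have P_mem: "\<And>i. i \<le> d \<Longrightarrow> P i \<in> mpoly_fun J"
      and P_zero: "\<forall>\<^sub>F v in U. (\<Sum>i\<le>d. P i v * v j ^ i) = 0"
      using P by (auto simp: alg_rel_def)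
    have "c' i \<in> mpoly_fun J" if "i \<le> e - 1" for i
      unfolding c'_def using that
      by (intro mpoly_fun_diff mpoly_fun.mult mpoly_fun_if P_mem less.prems) (auto simp: e)
    moreover have "\<forall>\<^sub>F v in U. (\<Sum>i\<le>e-1. c' i v * v j ^ i) = 0"
      using less.prems(2) P_zero by eventually_elim (simp only: id mult_zero_right diff_self)
    ultimately have "\<exists>E. finite E \<and> E \<subseteq> mpoly_fun J \<and> (\<forall>g\<in>E. \<forall>\<^sub>F v in U. g v = 0) \<and>
      (\<forall>v x. (\<forall>g\<in>E. g v = 0) \<longrightarrow> (\<Sum>i\<le>d. P i v * x ^ i) = 0 \<longrightarrow> P d v \<noteq> 0 \<longrightarrow>
        (\<Sum>i\<le>e-1. c' i v * x ^ i) = 0)" (is "\<exists>E. ?G E")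
      using \<open>e \<noteq> 0\<close> by (intro less.IH) simp_all
    then obtain E where E: "?G E" by (rule exE)
    show ?thesis
    proof (intro exI[of _ E] conjI allI impI)
      fix v x
      assume *: "\<forall>g\<in>E. g v = 0" "(\<Sum>i\<le>d. P i v * x ^ i) = 0" "P d v \<noteq> 0"
      with E have "(\<Sum>i\<le>e-1. c' i v * x ^ i) = 0" by blast
      then have "P d v * (\<Sum>i\<le>e. c i v * x ^ i) = 0"
        by (simp only: id *(2) mult_zero_right diff_zero)
      then show "(\<Sum>i\<le>e. c i v * x ^ i) = 0" using *(3) by simp
    qed (use E in blast)+
  qed
qed

section \<open>Sections built one coordinate at a time\<close>

definition jet_section ::
    "'i \<Rightarrow> 'i \<Rightarrow> 'i set \<Rightarrow> (('i \<Rightarrow> real) \<Rightarrow> real) set \<Rightarrow> ('i \<Rightarrow> real) \<Rightarrow> (real \<times> real \<Rightarrow> 'i \<Rightarrow> real) \<Rightarrow> bool"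
  where "jet_section \<alpha> \<beta> J E v \<sigma> \<longleftrightarrow>
    (\<forall>h. \<sigma> h \<alpha> = v \<alpha> + fst h \<and> \<sigma> h \<beta> = v \<beta> + snd h) \<and>
    (\<forall>i\<in>J. (\<lambda>h. \<sigma> h i) \<in> jet \<and> \<sigma> 0 i = v i) \<and>
    (\<forall>g\<in>E. \<forall>\<^sub>F h in nhds 0. g (\<sigma> h) = 0)"

lemma mpoly_fun_jet:
  assumes "f \<in> mpoly_fun J" "\<And>i. i \<in> J \<Longrightarrow> (\<lambda>h. \<sigma> h i) \<in> jet"
  shows "(\<lambda>h. f (\<sigma> h)) \<in> jet"
  using assms by (induction rule: mpoly_fun.induct) (auto intro: jet_const jet_add jet_mult)

text \<open>A coordinate that is free over the previous ones may stay constant: \<open>E\<close>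
  stands for the coefficients of \<open>E'\<close> with respect to it, and their vanishing gives
  \<open>E'\<close> for any value of the coordinate.\<close>

lemma jet_section_extend_const:
  assumes \<sigma>: "jet_section \<alpha> \<beta> J E v \<sigma>" and j: "j \<notin> J" "\<alpha> \<in> J" "\<beta> \<in> J"
    and E: "E \<subseteq> mpoly_fun J" "\<And>g w. g \<in> E' \<Longrightarrow> \<forall>f\<in>E. f w = 0 \<Longrightarrow> g w = 0"
    and "finite E"
  shows "jet_section \<alpha> \<beta> (insert j J) E' v (\<lambda>h. (\<sigma> h)(j := v j))"
proof -
  have eq: "f ((\<sigma> h)(j := v j)) = f (\<sigma> h)" if "f \<in> E" for f h
    using E(1) that j by (intro mpoly_fun_cong[of f J]) auto
  have "\<forall>\<^sub>F h in nhds 0. \<forall>f\<in>E. f (\<sigma> h) = 0"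
    using \<sigma> \<open>finite E\<close> by (auto simp: jet_section_def intro: eventually_ball_finite)
  then have "\<forall>\<^sub>F h in nhds 0. g ((\<sigma> h)(j := v j)) = 0" if "g \<in> E'" for g
  proof eventually_elim
    case (elim h)
    have "\<forall>f\<in>E. f ((\<sigma> h)(j := v j)) = 0"
      using elim by (simp add: eq)
    then show ?case by (rule E(2)[OF \<open>g \<in> E'\<close>])
  qed
  then show ?thesis using \<sigma> j jet_const by (auto simp: jet_section_def)
qed

text \<open>The simple root \<open>v j\<close> of \<open>P\<close> continues along the section by
  the implicit function. The leading coefficient stays nonzero near the origin, so the equations
  \<open>E\<close> left by pseudo-division still imply \<open>E'\<close>.\<close>

lemma jet_section_extend_alg:
  assumes \<sigma>: "jet_section \<alpha> \<beta> J E v \<sigma>" and j: "j \<notin> J" "\<alpha> \<in> J" "\<beta> \<in> J"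
    and E: "E \<subseteq> mpoly_fun J" "finite E"
    and P: "\<And>i. i \<le> d \<Longrightarrow> P i \<in> mpoly_fun J"
    and E': "\<And>g w. g \<in> E' \<Longrightarrow> \<forall>f\<in>E. f w = 0 \<Longrightarrow> (\<Sum>i\<le>d. P i w * w j ^ i) = 0 \<Longrightarrow>
      P d w \<noteq> 0 \<Longrightarrow> g w = 0"
    and root: "(\<Sum>i\<le>d. P i v * v j ^ i) = 0" and lead: "P d v \<noteq> 0"
    and deriv: "(\<Sum>i\<le>d. P i v * (\<Sum>k<i. v j ^ (i - Suc k) * v j ^ k)) \<noteq> 0"
  shows "\<exists>\<sigma>'. jet_section \<alpha> \<beta> (insert j J) E' v \<sigma>'"
proof -
  have jets: "\<And>i. i \<in> J \<Longrightarrow> (\<lambda>h. \<sigma> h i) \<in> jet" and \<sigma>0: "\<And>i. i \<in> J \<Longrightarrow> \<sigma> 0 i = v i"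
    using \<sigma> by (auto simp: jet_section_def)
  have P0: "P i (\<sigma> 0) = P i v" if "i \<le> d" for i
    by (rule mpoly_fun_cong[OF P[OF that] \<sigma>0])
  have P_jet: "(\<lambda>h. P i (\<sigma> h)) \<in> jet" if "i \<le> d" for i
    by (rule mpoly_fun_jet[OF P[OF that] jets])
  obtain y where y: "y \<in> jet" "y 0 = v j" "\<forall>\<^sub>F h in nhds 0. (\<Sum>i\<le>d. P i (\<sigma> h) * y h ^ i) = 0"
  proof (rule implicit_jet[of d "\<lambda>i h. P i (\<sigma> h)" "v j"])
    have eq: "(\<Sum>i\<le>d. P i (\<sigma> 0) * F i) = (\<Sum>i\<le>d. P i v * F i)" for F
      by (intro sum.cong) (auto simp: P0)
    show "(\<Sum>i\<le>d. P i (\<sigma> 0) * v j ^ i) = 0" unfolding eq by (rule root)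
    show "(\<Sum>i\<le>d. P i (\<sigma> 0) * (\<Sum>k<i. v j ^ (i - Suc k) * v j ^ k)) \<noteq> 0"
      unfolding eq by (rule deriv)
  qed (rule P_jet)
  define \<sigma>' where "\<sigma>' h = (\<sigma> h)(j := y h)" for h
  have eq: "f (\<sigma>' h) = f (\<sigma> h)" if "f \<in> mpoly_fun J" for f h
    unfolding \<sigma>'_def using that j by (intro mpoly_fun_cong[of f J]) auto
  have 1: "\<forall>\<^sub>F h in nhds 0. \<forall>f\<in>E. f (\<sigma> h) = 0"
    using \<sigma> \<open>finite E\<close> by (auto simp: jet_section_def intro: eventually_ball_finite)
  have 2: "\<forall>\<^sub>F h in nhds 0. P d (\<sigma> h) \<noteq> 0"
    using tendsto_imp_eventually_ne[OF lip0_tendsto[OF jet_lip0[OF P_jet[of d]]]] P0 lead by auto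
  have "\<forall>\<^sub>F h in nhds 0. g (\<sigma>' h) = 0" if "g \<in> E'" for g
    using 1 2 y(3)
  proof eventually_elim
    case (elim h)
    have "(\<Sum>i\<le>d. P i (\<sigma>' h) * \<sigma>' h j ^ i) = (\<Sum>i\<le>d. P i (\<sigma> h) * y h ^ i)"
      by (intro sum.cong) (auto simp: eq[OF P], simp add: \<sigma>'_def)
    then have "(\<Sum>i\<le>d. P i (\<sigma>' h) * \<sigma>' h j ^ i) = 0" using elim(3) by (rule trans)
    moreover have "P d (\<sigma>' h) \<noteq> 0" using elim(2) eq[OF P[of d]] by simp
    moreover have "\<forall>f\<in>E. f (\<sigma>' h) = 0"
      using elim(1) E(1) by (simp add: eq subset_iff)
    ultimately show ?case using E'[OF \<open>g \<in> E'\<close>, of "\<sigma>' h"] by blast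
  qed
  then have "jet_section \<alpha> \<beta> (insert j J) E' v \<sigma>'"
    using \<sigma> j y(1,2) by (auto simp: jet_section_def \<sigma>'_def)
  then show ?thesis by blast
qed

text \<open>The derivative of \<open>P\<close> in \<open>v j\<close> has leading coefficient
  \<open>d * P d\<close>, which does not vanish along \<open>U\<close>. If the derivative did, it
  would be a relation of degree \<open>d - 1\<close>. So a relation of least degree is
  separable.\<close>

lemma deriv_nonzero:
  assumes ultra: "\<And>P. (\<forall>\<^sub>F v in U. P v) \<or> (\<forall>\<^sub>F v in U. \<not> P v)"
    and P: "alg_rel U J j d P" and min: "\<And>d' c. d' < d \<Longrightarrow> \<not> alg_rel U J j d' c"
  shows "\<forall>\<^sub>F v in U. (\<Sum>i\<le>d. P i v * (\<Sum>k<i. v j ^ (i - Suc k) * v j ^ k)) \<noteq> 0"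
proof -
  have "d \<noteq> 0"
  proof
    assume "d = 0"
    then show False using P by (simp add: alg_rel_def)
  qed
  then obtain e where d: "d = Suc e" by (cases d) auto
  define c where "c i v = real (Suc i) * P (Suc i) v" for i v
  have eq: "(\<Sum>i\<le>d. P i v * (\<Sum>k<i. x ^ (i - Suc k) * x ^ k)) = (\<Sum>i\<le>e. c i v * x ^ i)" for v x
  proof -
    have "(\<Sum>k<i. x ^ (i - Suc k) * x ^ k) = real i * x ^ (i - 1)" for i
    proof -
      have "(\<Sum>k<i. x ^ (i - Suc k) * x ^ k) = (\<Sum>k<i. x ^ (i - 1))"
        by (intro sum.cong) (auto simp: power_add[symmetric])
      then show ?thesis by simp
    qed
    then have "(\<Sum>i\<le>d. P i v * (\<Sum>k<i. x ^ (i - Suc k) * x ^ k))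
        = (\<Sum>i\<le>Suc e. P i v * (real i * x ^ (i - 1)))"
      by (simp only: d)
    then show ?thesis by (subst (asm) sum.atMost_Suc_shift) (simp add: c_def mult_ac)
  qed
  have "\<not> (\<forall>\<^sub>F v in U. (\<Sum>i\<le>e. c i v * v j ^ i) = 0)"
  proof
    assume "\<forall>\<^sub>F v in U. (\<Sum>i\<le>e. c i v * v j ^ i) = 0"
    moreover have "\<not> (\<forall>\<^sub>F v in U. c e v = 0)" using P by (simp add: alg_rel_def c_def d)
    moreover have "c i \<in> mpoly_fun J" if "i \<le> e" for i
      unfolding c_def using P that by (intro mpoly_fun.mult mpoly_fun.const) (auto simp: alg_rel_def d)
    ultimately have "alg_rel U J j e c" by (simp add: alg_rel_def)
    then show False using min[of e c] d by simp
  qed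
  then show ?thesis unfolding eq using ultra[of "\<lambda>v. (\<Sum>i\<le>e. c i v * v j ^ i) = 0"] by blast
qed

text \<open>The claim is made along \<open>U\<close> rather than at one point, so that at each stage
  finitely many conditions (nonzero leading coefficient, nonzero derivative, a section for the
  previous coordinates) hold at a common \<open>v\<close>.\<close>

lemma generic_jet_section:
  fixes U :: "('i \<Rightarrow> real) filter"
  assumes "finite I" and "\<alpha> \<notin> I" "\<beta> \<notin> I" "\<alpha> \<noteq> \<beta>"
    and ultra: "\<And>P. (\<forall>\<^sub>F v in U. P v) \<or> (\<forall>\<^sub>F v in U. \<not> P v)"
    and indep: "\<And>q v. q \<in> mpoly_fun {\<alpha>, \<beta>} \<Longrightarrow> \<forall>\<^sub>F v in U. q v = 0 \<Longrightarrow> q v = 0"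
    and "finite E" "E \<subseteq> mpoly_fun (I \<union> {\<alpha>, \<beta>})" "\<forall>g\<in>E. \<forall>\<^sub>F v in U. g v = 0"
  shows "\<forall>\<^sub>F v in U. \<exists>\<sigma>. jet_section \<alpha> \<beta> (I \<union> {\<alpha>, \<beta>}) E v \<sigma>"
  using assms(1-3,7-)
proof (induction I arbitrary: E rule: finite_induct)
  case empty
  \<comment> \<open>Here the members of \<open>E\<close> are polynomials in the two base coordinates
    that vanish along \<open>U\<close>, so by independence they vanish identically and any
    translation of the plane will do.\<close>
  have "jet_section \<alpha> \<beta> {\<alpha>, \<beta>} E v (\<lambda>h. v(\<alpha> := v \<alpha> + fst h, \<beta> := v \<beta> + snd h))" for v
    using empty indep \<open>\<alpha> \<noteq> \<beta>\<close>
    by (auto simp: jet_section_def intro!: jet_add jet_const jet_fst jet_snd always_eventually)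
  then show ?case by (auto intro!: always_eventually)
next
  case (insert j I)
  define J where "J = I \<union> {\<alpha>, \<beta>}"
  have j: "j \<notin> J" "\<alpha> \<in> J" "\<beta> \<in> J" and J': "insert j I \<union> {\<alpha>, \<beta>} = insert j J"
    using insert by (auto simp: J_def)
  have "\<forall>g\<in>E. \<exists>d c. (\<forall>i\<le>d. c i \<in> mpoly_fun J) \<and> (\<forall>v. g v = (\<Sum>i\<le>d. c i v * v j ^ i))"
    using mpoly_fun_insert_expand[of _ j J] insert.prems(4) J' by auto
  then obtain dg cg where exp: "\<And>g i. g \<in> E \<Longrightarrow> i \<le> dg g \<Longrightarrow> cg g i \<in> mpoly_fun J"
    "\<And>g v. g \<in> E \<Longrightarrow> g v = (\<Sum>i\<le>dg g. cg g i v * v j ^ i)"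
    unfolding bchoice_iff by metis
  have ev: "\<forall>\<^sub>F v in U. (\<Sum>i\<le>dg g. cg g i v * v j ^ i) = 0" if "g \<in> E" for g
    using bspec[OF insert.prems(5) that] by (simp add: exp(2)[OF that])
  have IH: "\<forall>\<^sub>F v in U. \<exists>\<sigma>. jet_section \<alpha> \<beta> J E' v \<sigma>"
    if "finite E'" "E' \<subseteq> mpoly_fun J" "\<forall>g\<in>E'. \<forall>\<^sub>F v in U. g v = 0" for E'
    using insert.IH[of E'] insert.prems that by (auto simp: J_def)
  show ?case
  proof (cases "\<exists>d c. alg_rel U J j d c")
    case False
    \<comment> \<open>\<open>j\<close> is free over \<open>J\<close>, so every equation splits into
      its coefficients, which vanish along \<open>U\<close> separately.\<close>
    define E' where "E' = (\<Union>g\<in>E. cg g ` {..dg g})"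
    have "\<forall>\<^sub>F v in U. cg g i v = 0" if "g \<in> E" "i \<le> dg g" for g i
      using coeffs_vanish[of "dg g" U J j "cg g" i] False exp(1) ev that by auto
    then have "\<forall>\<^sub>F v in U. \<exists>\<sigma>. jet_section \<alpha> \<beta> J E' v \<sigma>"
      using exp(1) \<open>finite E\<close> by (intro IH) (auto simp: E'_def)
    then show ?thesis unfolding J'
    proof eventually_elim
      case (elim v)
      then obtain \<sigma> where \<sigma>: "jet_section \<alpha> \<beta> J E' v \<sigma>" by blast
      have red: "g w = 0" if "g \<in> E" "\<forall>f\<in>E'. f w = 0" for g w
      proof -
        have "cg g i w = 0" if "i \<le> dg g" for i
          using \<open>g \<in> E\<close> \<open>\<forall>f\<in>E'. f w = 0\<close> that by (auto simp: E'_def)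
        then have "(\<Sum>i\<le>dg g. cg g i w * w j ^ i) = 0" by (intro sum.neutral) simp
        then show ?thesis by (simp only: exp(2)[OF that(1)])
      qed
      have E': "E' \<subseteq> mpoly_fun J" "finite E'"
        using exp(1) \<open>finite E\<close> by (auto simp: E'_def)
      show ?case
      proof (rule exI, rule jet_section_extend_const[OF \<sigma> j E'(1) _ E'(2)])
        fix g w assume "g \<in> E" "\<forall>f\<in>E'. f w = 0"
        then show "g w = 0" by (rule red)
      qed
    qed
  next
    case True
    define d where "d = (LEAST d. \<exists>c. alg_rel U J j d c)"
    obtain P where P: "alg_rel U J j d P" using LeastI_ex[OF True] unfolding d_def by blast
    have min: "\<not> alg_rel U J j d' c" if "d' < d" for d' c
      using not_less_Least[of d' "\<lambda>d. \<exists>c. alg_rel U J j d c"] that unfolding d_def by blast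
    have "\<forall>g\<in>E. \<exists>E. finite E \<and> E \<subseteq> mpoly_fun J \<and> (\<forall>g\<in>E. \<forall>\<^sub>F v in U. g v = 0) \<and>
      (\<forall>v x. (\<forall>g\<in>E. g v = 0) \<longrightarrow> (\<Sum>i\<le>d. P i v * x ^ i) = 0 \<longrightarrow> P d v \<noteq> 0 \<longrightarrow>
        (\<Sum>i\<le>dg g. cg g i v * x ^ i) = 0)"
    proof
      fix g assume "g \<in> E"
      show "\<exists>E. finite E \<and> E \<subseteq> mpoly_fun J \<and> (\<forall>g\<in>E. \<forall>\<^sub>F v in U. g v = 0) \<and>
        (\<forall>v x. (\<forall>g\<in>E. g v = 0) \<longrightarrow> (\<Sum>i\<le>d. P i v * x ^ i) = 0 \<longrightarrow> P d v \<noteq> 0 \<longrightarrow>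
          (\<Sum>i\<le>dg g. cg g i v * x ^ i) = 0)"
        by (rule pseudo_division[OF P min exp(1)[OF \<open>g \<in> E\<close>] ev[OF \<open>g \<in> E\<close>]])
    qed
    from bchoice[OF this] obtain Eg where Eg: "\<forall>g\<in>E. finite (Eg g) \<and> Eg g \<subseteq> mpoly_fun J \<and>
      (\<forall>f\<in>Eg g. \<forall>\<^sub>F v in U. f v = 0) \<and>
      (\<forall>v x. (\<forall>f\<in>Eg g. f v = 0) \<longrightarrow> (\<Sum>i\<le>d. P i v * x ^ i) = 0 \<longrightarrow> P d v \<noteq> 0 \<longrightarrow>
        (\<Sum>i\<le>dg g. cg g i v * x ^ i) = 0)"
      by (rule exE)
    \<comment> \<open>Here \<open>j\<close> is algebraic over \<open>J\<close>; \<open>E'\<close>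
      collects the conditions on the previous coordinates that remain after reduction modulo
      \<open>P\<close>.\<close>
    define E' where "E' = (\<Union>g\<in>E. Eg g)"
    have E': "finite E'" "E' \<subseteq> mpoly_fun J" "\<forall>g\<in>E'. \<forall>\<^sub>F v in U. g v = 0"
      using Eg \<open>finite E\<close> unfolding E'_def by (blast intro: finite_UN_I)+
    have "\<forall>\<^sub>F v in U. P d v \<noteq> 0"
      using P ultra[of "\<lambda>v. P d v = 0"] by (auto simp: alg_rel_def)
    moreover have "\<forall>\<^sub>F v in U. (\<Sum>i\<le>d. P i v * v j ^ i) = 0" using P by (simp add: alg_rel_def)
    moreover have "\<forall>\<^sub>F v in U. (\<Sum>i\<le>d. P i v * (\<Sum>k<i. v j ^ (i - Suc k) * v j ^ k)) \<noteq> 0"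
      by (rule deriv_nonzero[OF ultra P]) (rule min)
    moreover note IH[OF E']
    ultimately show ?thesis unfolding J'
    proof eventually_elim
      case (elim v)
      then obtain \<sigma> where \<sigma>: "jet_section \<alpha> \<beta> J E' v \<sigma>" by blast
      have red: "g w = 0" if "g \<in> E" "\<forall>f\<in>E'. f w = 0"
        "(\<Sum>i\<le>d. P i w * w j ^ i) = 0" "P d w \<noteq> 0" for g w
      proof -
        have "\<forall>f\<in>Eg g. f w = 0"
          using that(1,2) by (auto simp: E'_def)
        then have "(\<Sum>i\<le>dg g. cg g i w * w j ^ i) = 0" using Eg that(1,3,4) by blast
        then show ?thesis by (simp only: exp(2)[OF that(1)])
      qed
      have P_mem: "P i \<in> mpoly_fun J" if "i \<le> d" for i
        using P that by (auto simp: alg_rel_def)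
      show ?case
      proof (rule jet_section_extend_alg[OF \<sigma> j E'(2,1) P_mem _ elim(2,1,3)])
        fix g w
        assume "g \<in> E" "\<forall>f\<in>E'. f w = 0" "(\<Sum>i\<le>d. P i w * w j ^ i) = 0" "P d w \<noteq> 0"
        then show "g w = 0" by (rule red)
      qed
    qed
  qed
qed

text \<open>By density some ultrafilter contains \<open>X\<close> and avoids the preimages of all
  plane curves. At a generic point each member of \<open>\<Phi>\<close> either vanishes along the
  section or is nonzero and keeps its sign by continuity, so the section stays in
  \<open>X\<close>.\<close>

lemma jet_section_in_set:
  fixes X :: "('i \<Rightarrow> real) set"
  assumes "finite I" and "\<alpha> \<notin> I" "\<beta> \<notin> I" "\<alpha> \<noteq> \<beta>"
    and \<Phi>: "finite \<Phi>" "\<Phi> \<subseteq> mpoly_fun (I \<union> {\<alpha>, \<beta>})"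
    and X: "\<And>v w. v \<in> X \<Longrightarrow> (\<And>g. g \<in> \<Phi> \<Longrightarrow> sgn (g w) = sgn (g v)) \<Longrightarrow> w \<in> X"
    and dense: "\<And>q v. q \<in> mpoly_fun {\<alpha>, \<beta>} \<Longrightarrow> (\<And>v. v \<in> X \<Longrightarrow> q v = 0) \<Longrightarrow> q v = 0"
  obtains v \<sigma> where "v \<in> X" "jet_section \<alpha> \<beta> (I \<union> {\<alpha>, \<beta>}) {} v \<sigma>" "\<forall>\<^sub>F h in nhds 0. \<sigma> h \<in> X"
proof -
  define N where "N = {q \<in> mpoly_fun {\<alpha>, \<beta>}. \<exists>v. q v \<noteq> 0}"
  have "\<Inter>Y \<noteq> {}" if Y: "finite Y" "Y \<subseteq> (\<lambda>q. {v \<in> X. q v \<noteq> 0}) ` N" for Y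
  proof -
    obtain Q where Q: "Q \<subseteq> N" "finite Q" "Y = (\<lambda>q. {v \<in> X. q v \<noteq> 0}) ` Q"
      using finite_subset_image[OF Y] by blast
    have "\<exists>f\<in>mpoly_fun {\<alpha>, \<beta>}. (\<exists>v. f v \<noteq> 0) \<and> (\<forall>v. f v = (\<Prod>q\<in>Q. q v))"
      using Q by (intro mpoly_fun_prod_nonzero) (auto simp: N_def)
    then obtain f w where f: "f \<in> mpoly_fun {\<alpha>, \<beta>}" "f w \<noteq> 0" "\<And>v. f v = (\<Prod>q\<in>Q. q v)"
      by blast
    then obtain v where "v \<in> X" "f v \<noteq> 0" using dense[of f w] by blast
    then have "v \<in> \<Inter>Y" using Q f(3)[of v] by auto
    then show ?thesis by blast
  qed
  then obtain U :: "('i \<Rightarrow> real) filter" where U: "U \<noteq> bot"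
    "\<And>A. A \<in> (\<lambda>q. {v \<in> X. q v \<noteq> 0}) ` N \<Longrightarrow> \<forall>\<^sub>F x in U. x \<in> A"
    "\<And>P. (\<forall>\<^sub>F x in U. P x) \<or> (\<forall>\<^sub>F x in U. \<not> P x)"
    using ultrafilter_extension[of "(\<lambda>q. {v \<in> X. q v \<noteq> 0}) ` N"] by blast
  have evN: "\<forall>\<^sub>F v in U. v \<in> X \<and> q v \<noteq> 0" if "q \<in> N" for q
    using U(2)[of "{v \<in> X. q v \<noteq> 0}"] that by auto
  have indep: "q v = 0" if "q \<in> mpoly_fun {\<alpha>, \<beta>}" "\<forall>\<^sub>F v in U. q v = 0" for q v
  proof (rule ccontr)
    assume "q v \<noteq> 0"
    with that(1) have "\<forall>\<^sub>F v in U. v \<in> X \<and> q v \<noteq> 0" by (intro evN) (auto simp: N_def)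
    with that(2) have "\<forall>\<^sub>F v in U. False" by eventually_elim auto
    then show False using U(1) by (simp add: trivial_limit_def)
  qed
  define E where "E = {g \<in> \<Phi>. \<forall>\<^sub>F v in U. g v = 0}"
  have "\<forall>\<^sub>F v in U. \<exists>\<sigma>. jet_section \<alpha> \<beta> (I \<union> {\<alpha>, \<beta>}) E v \<sigma>"
    using assms(1-4) U(3) indep \<Phi> by (intro generic_jet_section) (auto simp: E_def)
  moreover have "\<forall>\<^sub>F v in U. v \<in> X"
    using evN[of "\<lambda>_. 1"] by (auto simp: N_def intro: mpoly_fun.const elim: eventually_mono)
  moreover have "\<forall>\<^sub>F v in U. \<forall>g\<in>\<Phi> - E. g v \<noteq> 0"
    using U(3) \<Phi>(1) by (intro eventually_ball_finite) (auto simp: E_def)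
  ultimately have "\<forall>\<^sub>F v in U. v \<in> X \<and> (\<exists>\<sigma>. jet_section \<alpha> \<beta> (I \<union> {\<alpha>, \<beta>}) E v \<sigma>) \<and>
      (\<forall>g\<in>\<Phi> - E. g v \<noteq> 0)"
    by eventually_elim auto
  then obtain v \<sigma> where v: "v \<in> X" and \<sigma>: "jet_section \<alpha> \<beta> (I \<union> {\<alpha>, \<beta>}) E v \<sigma>"
    and nz: "\<forall>g\<in>\<Phi> - E. g v \<noteq> 0"
    using eventually_happens'[OF U(1)] by blast
  have sgn: "\<forall>\<^sub>F h in nhds 0. sgn (g (\<sigma> h)) = sgn (g v)" if "g \<in> \<Phi>" for g
  proof -
    have g: "g \<in> mpoly_fun (I \<union> {\<alpha>, \<beta>})" using \<Phi>(2) that by blast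
    have g0: "g (\<sigma> 0) = g v"
      by (rule mpoly_fun_cong[OF g]) (use \<sigma> in \<open>auto simp: jet_section_def\<close>)
    have lim: "((\<lambda>h. g (\<sigma> h)) \<longlongrightarrow> g v) (nhds 0)"
      using lip0_tendsto[OF jet_lip0[OF mpoly_fun_jet[OF g]], of \<sigma>] \<sigma> g0
      by (auto simp: jet_section_def)
    have "g \<notin> E \<Longrightarrow> g v \<noteq> 0" using nz that by blast
    then have "g \<in> E \<or> g v > 0 \<or> g v < 0" by linarith
    then consider "g \<in> E" | "g v > 0" | "g v < 0" by blast
    then show ?thesis
    proof cases
      case 1
      then have z: "\<forall>\<^sub>F h in nhds 0. g (\<sigma> h) = 0" using \<sigma> by (auto simp: jet_section_def)
      have "g v = 0" using eventually_nhds_x_imp_x[OF z] g0 by simp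
      with z show ?thesis by (auto elim: eventually_mono)
    next
      case 2
      then show ?thesis using order_tendstoD(1)[OF lim 2] by (auto elim!: eventually_mono)
    next
      case 3
      then show ?thesis using order_tendstoD(2)[OF lim 3] by (auto elim!: eventually_mono)
    qed
  qed
  then have "\<forall>\<^sub>F h in nhds 0. \<forall>g\<in>\<Phi>. sgn (g (\<sigma> h)) = sgn (g v)"
    using \<Phi>(1) by (intro eventually_ball_finite) auto
  then have "\<forall>\<^sub>F h in nhds 0. \<sigma> h \<in> X"
    by eventually_elim (use X[OF v] in blast)
  moreover have "jet_section \<alpha> \<beta> (I \<union> {\<alpha>, \<beta>}) {} v \<sigma>"
    using \<sigma> by (simp add: jet_section_def)
  ultimately show ?thesis using v that by blast
qed

section \<open>Algebraically independent polynomials on a set of dimension at least two\<close>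

lemma mpoly_fun_compose_real_polynomial:
  assumes "f \<in> mpoly_fun J" "\<And>i. i \<in> J \<Longrightarrow> real_polynomial_function (\<lambda>x. s x i)"
  shows "real_polynomial_function (\<lambda>x. f (s x))"
  using assms by (induction rule: mpoly_fun.induct) auto

text \<open>Primality is unpacked into statements about functions to keep ring records out of the
  chain argument; the last clause is properness.\<close>

definition prime_fun_ideal :: "('a::real_normed_vector \<Rightarrow> real) set \<Rightarrow> bool"
  where "prime_fun_ideal p \<longleftrightarrow>
    (\<forall>f\<in>p. real_polynomial_function f) \<and>
    (\<forall>f\<in>p. \<forall>g. real_polynomial_function g \<longrightarrow> (\<lambda>x. g x * f x) \<in> p) \<and>
    (\<forall>f\<in>p. \<forall>g\<in>p. (\<lambda>x. f x + g x) \<in> p) \<and>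
    (\<forall>f g. real_polynomial_function f \<longrightarrow> real_polynomial_function g \<longrightarrow> (\<lambda>x. f x * g x) \<in> p \<longrightarrow>
      f \<in> p \<or> g \<in> p) \<and>
    (\<forall>c. c \<noteq> 0 \<longrightarrow> (\<lambda>x. c) \<notin> p)"

lemma prime_fun_ideal_mult:
  "prime_fun_ideal p \<Longrightarrow> f \<in> p \<Longrightarrow> real_polynomial_function g \<Longrightarrow> (\<lambda>x. g x * f x) \<in> p"
  and prime_fun_ideal_add:
  "prime_fun_ideal p \<Longrightarrow> f \<in> p \<Longrightarrow> g \<in> p \<Longrightarrow> (\<lambda>x. f x + g x) \<in> p"
  and prime_fun_ideal_prime:
  "prime_fun_ideal p \<Longrightarrow> (\<lambda>x. f x * g x) \<in> p \<Longrightarrow> f \<notin> p \<Longrightarrow>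
    real_polynomial_function f \<Longrightarrow> real_polynomial_function g \<Longrightarrow> g \<in> p"
  unfolding prime_fun_ideal_def by (elim conjE; blast)+

lemma primeideal_prime_fun_ideal:
  assumes "primeideal p (polynomial_ring :: (real ^ 'm \<Rightarrow> real) ring)"
  shows "prime_fun_ideal p"
proof -
  let ?R = "polynomial_ring :: (real ^ 'm \<Rightarrow> real) ring"
  interpret primeideal p ?R by fact
  have carrier: "f \<in> carrier ?R \<longleftrightarrow> real_polynomial_function f" for f
    by (simp add: polynomial_ring_def)
  have mult: "f \<otimes>\<^bsub>?R\<^esub> g = (\<lambda>x. f x * g x)" and add: "f \<oplus>\<^bsub>?R\<^esub> g = (\<lambda>x. f x + g x)"
    and one: "\<one>\<^bsub>?R\<^esub> = (\<lambda>x. 1)" for f g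
    by (simp_all add: polynomial_ring_def)
  show ?thesis unfolding prime_fun_ideal_def
  proof (intro conjI ballI allI impI notI)
    show "real_polynomial_function f" if "f \<in> p" for f
      using a_Hcarr[OF that] by (simp add: carrier)
    show "(\<lambda>x. g x * f x) \<in> p" if "f \<in> p" "real_polynomial_function g" for f g
      using I_l_closed[of f g] that by (simp add: carrier mult)
    show "(\<lambda>x. f x + g x) \<in> p" if "f \<in> p" "g \<in> p" for f g
      using additive_subgroup.a_closed[OF is_additive_subgroup that] by (simp add: add)
    show "f \<in> p \<or> g \<in> p"
      if "real_polynomial_function f" "real_polynomial_function g" "(\<lambda>x. f x * g x) \<in> p" for f g
      using I_prime[of f g] that by (simp add: carrier mult)
    fix c :: real assume "c \<noteq> 0" "(\<lambda>x. c) \<in> p"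
    then have "(\<lambda>x. 1) \<in> p"
      using I_l_closed[of "\<lambda>x. c" "\<lambda>x. 1 / c"] by (simp add: carrier mult real_polynomial_function.intros(2))
    then have "carrier ?R = p" using one_imp_carrier by (simp add: one)
    then show False using I_notcarr by blast
  qed
qed

text \<open>The relation is \<open>a ^ k\<close> times \<open>f k + r * a\<close>. As
  \<open>a\<close> is outside the prime \<open>p\<close>, the second factor lies in
  \<open>p\<close>, hence in \<open>p'\<close>, and there \<open>r * a\<close> can be subtracted. So
  a relation in \<open>p\<close> passes to its lowest coefficient in \<open>p'\<close>.\<close>

lemma prime_chain_step:
  assumes p: "prime_fun_ideal p" and p': "prime_fun_ideal p'" and sub: "p \<subseteq> p'"
    and a: "a \<in> p'" "a \<notin> p"
    and f: "\<And>i. i \<le> d \<Longrightarrow> real_polynomial_function (f i)"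
    and mem: "(\<lambda>x. \<Sum>i\<le>d. f i x * a x ^ i) \<in> p"
    and k: "k \<le> d" "\<And>i x. i < k \<Longrightarrow> f i x = 0"
  shows "f k \<in> p'"
proof -
  have a_poly: "real_polynomial_function a" using p' a(1) by (auto simp: prime_fun_ideal_def)
  define r where "r x = (\<Sum>i<d-k. f (k + Suc i) x * a x ^ i)" for x
  have r_poly: "real_polynomial_function r"
    unfolding r_def by (intro real_polynomial_function_sum real_polynomial_function.intros(4)
        real_polynomial_function_power f a_poly) auto
  have r_mult: "real_polynomial_function (\<lambda>x. f k x + r x * a x)"
    using f[OF k(1)] r_poly a_poly by auto
  have eq: "(\<Sum>i\<le>d. f i x * a x ^ i) = a x ^ k * (f k x + r x * a x)" for x
  proof -
    have "(\<Sum>i\<le>d. f i x * a x ^ i) = (\<Sum>i\<in>{0+k..(d-k)+k}. f i x * a x ^ i)"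
      using k by (intro sum.mono_neutral_right) auto
    also have "\<dots> = (\<Sum>i\<le>d-k. f (i + k) x * a x ^ (i + k))"
      by (subst sum.shift_bounds_cl_nat_ivl) (simp add: atLeast0AtMost)
    also have "\<dots> = f k x * a x ^ k + (\<Sum>i<d-k. f (Suc i + k) x * a x ^ (Suc i + k))"
      by (subst sum.atMost_shift) simp
    also have "(\<Sum>i<d-k. f (Suc i + k) x * a x ^ (Suc i + k)) = a x ^ k * (r x * a x)"
      by (simp add: r_def sum_distrib_left sum_distrib_right power_add add_ac mult_ac)
    finally show ?thesis by (simp add: algebra_simps)
  qed
  have "(\<lambda>x. f k x + r x * a x) \<in> p"
  proof -
    have "(\<lambda>x. a x ^ j * (f k x + r x * a x)) \<in> p \<Longrightarrow> (\<lambda>x. f k x + r x * a x) \<in> p" for j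
    proof (induction j)
      case (Suc j)
      have "real_polynomial_function (\<lambda>x. a x ^ j * (f k x + r x * a x))"
        using r_mult a_poly by (intro real_polynomial_function.intros(4) real_polynomial_function_power)
      moreover have "(\<lambda>x. a x * (a x ^ j * (f k x + r x * a x))) \<in> p"
        using Suc.prems by (simp add: mult_ac)
      ultimately have "(\<lambda>x. a x ^ j * (f k x + r x * a x)) \<in> p"
        using prime_fun_ideal_prime[OF p _ a(2) a_poly,
            where g = "\<lambda>x. a x ^ j * (f k x + r x * a x)"] by blast
      then show ?case by (rule Suc.IH)
    qed simp
    then show ?thesis using mem unfolding eq by blast
  qed
  then have "(\<lambda>x. f k x + r x * a x) \<in> p'" using sub by blast
  moreover have "(\<lambda>x. (- r x) * a x) \<in> p'"
    by (rule prime_fun_ideal_mult[OF p' a(1) real_polynomial_function_minus[OF r_poly]])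
  ultimately have "(\<lambda>x. (f k x + r x * a x) + (- r x) * a x) \<in> p'"
    by (rule prime_fun_ideal_add[OF p'])
  then show ?thesis by simp
qed

text \<open>A supremum of at least 2 needs a chain of some length \<open>n \<ge> 2\<close>. Its
  primes are pulled back along the quotient map, whose surjectivity keeps the inclusions
  strict.\<close>

lemma prime_chain_coordinate_ring:
  fixes V :: "(real ^ 'm) set"
  assumes "krull_dim (coordinate_ring V) \<ge> 2"
  obtains p :: "nat \<Rightarrow> (real ^ 'm \<Rightarrow> real) set"
  where "\<And>i. i \<le> 2 \<Longrightarrow> prime_fun_ideal (p i)" "vanishing_ideal V \<subseteq> p 0" "p 0 \<subset> p 1" "p 1 \<subset> p 2"
proof -
  let ?R = "polynomial_ring :: (real ^ 'm \<Rightarrow> real) ring" and ?I = "vanishing_ideal V"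
  let ?Q = "?R Quot ?I"
  let ?N = "{n. \<exists>P. (\<forall>i\<le>n. primeideal (P i) ?Q) \<and> (\<forall>i<n. P i \<subset> P (Suc i))}"
  have "\<exists>n\<in>?N. n \<ge> 2"
  proof (rule ccontr)
    assume no: "\<not> ?thesis"
    have le: "n \<le> 1" if "n \<in> ?N" for n
    proof (rule ccontr)
      assume "\<not> n \<le> 1"
      then have "n \<ge> 2" by simp
      then have "\<exists>n\<in>?N. n \<ge> 2" using that by (rule bexI)
      then show False using no by contradiction
    qed
    have "(SUP n\<in>?N. enat n) \<le> 1"
      by (rule SUP_least) (use le in \<open>simp only: one_enat_def enat_ord_simps\<close>)
    moreover have "krull_dim (coordinate_ring V) = (SUP n\<in>?N. enat n)"
      by (simp only: krull_dim_def coordinate_ring_def)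
    ultimately have "(2::enat) \<le> 1" using assms by (metis order_trans)
    then show False by simp
  qed
  then obtain n P where n: "n \<ge> 2" and P: "\<And>i. i \<le> n \<Longrightarrow> primeideal (P i) ?Q"
    "\<And>i. i < n \<Longrightarrow> P i \<subset> P (Suc i)" by blast
  have ideal: "ideal ?I ?R" by (rule ideal_vanishing_ideal)
  interpret hom: ring_hom_ring ?R ?Q "(+>\<^bsub>?R\<^esub>) ?I"
    using ideal by (rule ideal.rcos_ring_hom_ring)
  define p where "p i = {r \<in> carrier ?R. ?I +>\<^bsub>?R\<^esub> r \<in> P i}" for i
  have prime: "primeideal (p i) ?R" if "i \<le> n" for i
    unfolding p_def by (rule hom.primeideal_vimage[OF cring_polynomial_ring P(1)[OF that]])
  have strict: "p i \<subset> p (Suc i)" if "i < n" for i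
  proof -
    obtain y where y: "y \<in> P (Suc i)" "y \<notin> P i" using P(2)[OF \<open>i < n\<close>] by blast
    have "y \<in> carrier ?Q"
      using ideal.Icarr[OF primeideal.axioms(1)[OF P(1)[of "Suc i"]] y(1)] \<open>i < n\<close> by simp
    then obtain r where "r \<in> carrier ?R" "y = ?I +>\<^bsub>?R\<^esub> r"
      unfolding FactRing_def A_RCOSETS_def' by auto
    then show ?thesis using y P(2)[OF \<open>i < n\<close>] by (auto simp: p_def)
  qed
  have "?I \<subseteq> p 0"
  proof
    fix f assume f: "f \<in> ?I"
    then have carr: "f \<in> carrier ?R" using ideal.Icarr[OF ideal] by blast
    have "?I +>\<^bsub>?R\<^esub> f = ?I"
      using f ideal by (rule hom.R.a_rcos_zero[rotated])
    then have "?I +>\<^bsub>?R\<^esub> f = \<zero>\<^bsub>?Q\<^esub>"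
      by (simp only: FactRing_def ring_record_simps)
    moreover have "\<zero>\<^bsub>?Q\<^esub> \<in> P 0"
      by (rule additive_subgroup.zero_closed[OF ideal.axioms(1)[OF primeideal.axioms(1)[OF P(1)[OF le0]]]])
    ultimately show "f \<in> p 0" using carr by (simp only: p_def mem_Collect_eq)
  qed
  then show ?thesis
    using that[of p] primeideal_prime_fun_ideal[OF prime] n strict[of 0] strict[of 1]
    by (simp add: numeral_2_eq_2)
qed

text \<open>With \<open>a\<close> in \<open>p 1 - p 0\<close> and \<open>b\<close> in
  \<open>p 2 - p 1\<close>, a nontrivial relation between \<open>a\<close> and \<open>b\<close> on
  \<open>S\<close> lies in \<open>p 0\<close>. Two steps up the chain reduce it to a nonzero
  polynomial in \<open>b\<close> inside \<open>p 1\<close> and then to a nonzero constant inside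
  \<open>p 2\<close>, which is absurd.\<close>

lemma independent_pair:
  fixes S :: "(real ^ 'm) set" and \<alpha> \<beta> :: 'i
  assumes dim: "semialg_dim S \<ge> 2" and "\<alpha> \<noteq> \<beta>"
  obtains a b where "real_polynomial_function a" "real_polynomial_function b"
    "\<forall>q\<in>mpoly_fun {\<alpha>, \<beta>}. (\<forall>x\<in>S. q (\<lambda>i. if i = \<alpha> then a x else b x) = 0) \<longrightarrow> (\<forall>v. q v = 0)"
proof -
  obtain p :: "nat \<Rightarrow> (real ^ 'm \<Rightarrow> real) set"
    where p: "\<And>i. i \<le> 2 \<Longrightarrow> prime_fun_ideal (p i)"
      "vanishing_ideal (zariski_closure S) \<subseteq> p 0" "p 0 \<subset> p 1" "p 1 \<subset> p 2"
    using prime_chain_coordinate_ring[OF dim[unfolded semialg_dim_def]] by blast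
  obtain a where a: "a \<in> p 1" "a \<notin> p 0" using p(3) by blast
  obtain b where b: "b \<in> p 2" "b \<notin> p 1" using p(4) by blast
  have a_poly: "real_polynomial_function a" using p(1)[of 1] a(1) by (auto simp: prime_fun_ideal_def)
  have b_poly: "real_polynomial_function b" using p(1)[of 2] b(1) by (auto simp: prime_fun_ideal_def)
  define s where "s x i = (if i = \<alpha> then a x else b x)" for x i
  have s_poly: "real_polynomial_function (\<lambda>x. f (s x))" if "f \<in> mpoly_fun J" for f J
    using that
  proof (rule mpoly_fun_compose_real_polynomial)
    show "real_polynomial_function (\<lambda>x. s x i)" for i
      by (cases "i = \<alpha>") (simp_all add: s_def a_poly b_poly)
  qed
  have "q v = 0" if q: "q \<in> mpoly_fun {\<alpha>, \<beta>}" and van: "\<And>x. x \<in> S \<Longrightarrow> q (s x) = 0" for q v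
  proof (rule ccontr)
    assume "q v \<noteq> 0"
    obtain d c where c: "\<forall>i\<le>d. c i \<in> mpoly_fun {\<beta>}" "\<forall>v. q v = (\<Sum>i\<le>d. c i v * v \<alpha> ^ i)"
      using mpoly_fun_insert_expand[OF q] by blast
    have "\<exists>k\<le>d. \<exists>w. c k w \<noteq> 0"
    proof (rule ccontr)
      assume "\<not> ?thesis"
      then have "q v = 0" using c(2) by simp
      then show False using \<open>q v \<noteq> 0\<close> by simp
    qed
    then obtain k where k: "k \<le> d" "\<exists>w. c k w \<noteq> 0" and k_min: "\<And>i. i < k \<Longrightarrow> \<not> (i \<le> d \<and> (\<exists>w. c i w \<noteq> 0))"
      using exists_least_iff[of "\<lambda>k. k \<le> d \<and> (\<exists>w. c k w \<noteq> 0)"] by blast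
    have "(\<lambda>x. q (s x)) \<in> vanishing_ideal (zariski_closure S)"
      using s_poly[OF q] van by (auto simp: vanishing_ideal_def zariski_closure_def)
    moreover have "(\<lambda>x. q (s x)) = (\<lambda>x. \<Sum>i\<le>d. c i (s x) * a x ^ i)"
      using c(2) by (simp add: s_def)
    ultimately have "(\<lambda>x. \<Sum>i\<le>d. c i (s x) * a x ^ i) \<in> p 0" using p(2) by auto
    have ck: "(\<lambda>x. c k (s x)) \<in> p 1"
    proof (rule prime_chain_step[where p = "p 0" and a = a and d = d and f = "\<lambda>i x. c i (s x)"])
      show "(\<lambda>x. \<Sum>i\<le>d. c i (s x) * a x ^ i) \<in> p 0" by fact
      show "real_polynomial_function (\<lambda>x. c i (s x))" if "i \<le> d" for i
        by (rule s_poly) (use c(1) that in blast)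
      show "c i (s x) = 0" if "i < k" for i x using k_min[OF that] that k(1) by simp
      show "p 0 \<subseteq> p 1" using p(3) by blast
    qed (use a k(1) p(1)[of 0] p(1)[of 1] in simp_all)
    have ck_mem: "c k \<in> mpoly_fun (insert \<beta> {})" using c(1) k(1) by blast
    obtain e g where g: "\<forall>i\<le>e. g i \<in> mpoly_fun {}" "\<forall>v. c k v = (\<Sum>i\<le>e. g i v * v \<beta> ^ i)"
      using mpoly_fun_insert_expand[OF ck_mem] by blast
    define t where "t i = g i (\<lambda>_. 0)" for i
    have gt: "g i v = t i" if "i \<le> e" for i v
      unfolding t_def by (rule mpoly_fun_cong[of "g i" "{}"]) (use g(1) that in simp_all)
    have ct: "c k v = (\<Sum>i\<le>e. t i * v \<beta> ^ i)" for v using g(2) gt by simp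
    have "\<exists>l\<le>e. t l \<noteq> 0"
    proof (rule ccontr)
      assume "\<not> ?thesis"
      then have "c k w = 0" for w using ct[of w] by simp
      then show False using k(2) by blast
    qed
    then obtain l where l: "l \<le> e" "t l \<noteq> 0" and l_min: "\<And>i. i < l \<Longrightarrow> \<not> (i \<le> e \<and> t i \<noteq> 0)"
      using exists_least_iff[of "\<lambda>l. l \<le> e \<and> t l \<noteq> 0"] by blast
    have "(\<lambda>x. \<Sum>i\<le>e. t i * b x ^ i) \<in> p 1"
      using ck \<open>\<alpha> \<noteq> \<beta>\<close> by (simp add: ct s_def)
    have "(\<lambda>x. t l) \<in> p 2"
    proof (rule prime_chain_step[where p = "p 1" and a = b and d = e and f = "\<lambda>i x. t i"])
      show "(\<lambda>x. \<Sum>i\<le>e. t i * b x ^ i) \<in> p 1" by fact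
      show "t i = 0" if "i < l" for i using l_min[OF that] that l(1) by simp
      show "p 1 \<subseteq> p 2" using p(4) by blast
    qed (use b l(1) p(1)[of 1] p(1)[of 2] in \<open>auto intro: real_polynomial_function.intros(2)\<close>)
    then show False using p(1)[of 2] l(2) by (auto simp: prime_fun_ideal_def)
  qed
  then have "\<forall>q\<in>mpoly_fun {\<alpha>, \<beta>}. (\<forall>x\<in>S. q (s x) = 0) \<longrightarrow> (\<forall>v. q v = 0)" by blast
  then show ?thesis by (intro that[OF a_poly b_poly]) (simp only: s_def[abs_def])
qed

section \<open>Factorisation of positive semidefinite matrices\<close>

text \<open>Cholesky elimination of the last variable: the Schur complement \<open>B\<close> of the
  last diagonal entry is again positive semidefinite, and a factor of \<open>B\<close> is enlarged
  by one row and one column.\<close>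

lemma psd_factorization:
  assumes "psd_matrix d A"
  obtains Z where "\<forall>i<d. \<forall>j<d. A i j = (\<Sum>k<d. Z i k * Z j k)"
proof -
  have "\<exists>Z. \<forall>i<d. \<forall>j<d. A i j = (\<Sum>k<d. Z i k * Z j k)" using assms
  proof (induction d arbitrary: A)
    case (Suc d)
    have sym: "A i j = A j i" if "i < Suc d" "j < Suc d" for i j
      using Suc.prems that by (auto simp: psd_matrix_def sym_matrix_def)
    define L where "L v = (\<Sum>i<d. v i * A i d)" for v :: "nat \<Rightarrow> real"
    define q where "q v = (\<Sum>i<d. \<Sum>j<d. v i * A i j * v j)" for v :: "nat \<Rightarrow> real"
    have form: "0 \<le> q v + 2 * x * L v + x\<^sup>2 * A d d" for v x
    proof -
      let ?v = "v(d := x)"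
      have "0 \<le> (\<Sum>i<Suc d. \<Sum>j<Suc d. ?v i * A i j * ?v j)"
        using Suc.prems unfolding psd_matrix_def by blast
      also have "\<dots> = (\<Sum>i<d. (\<Sum>j<d. v i * A i j * v j) + v i * A i d * x)
          + ((\<Sum>j<d. x * A d j * v j) + x * A d d * x)"
        by simp
      also have "(\<Sum>j<d. x * A d j * v j) = (\<Sum>j<d. v j * A j d * x)"
        by (intro sum.cong) (auto simp: sym[of d])
      finally show ?thesis
        by (simp add: q_def L_def sum.distrib sum_distrib_left power2_eq_square algebra_simps)
    qed
    define a where "a = A d d"
    have a: "a \<ge> 0" using form[of "\<lambda>_. 0" 1] by (simp add: q_def L_def a_def)
    \<comment> \<open>With a zero pivot the form is affine in the last coordinate \<open>x\<close>,
      so nonnegativity forces its slope to be 0; the value of \<open>x\<close> used below would make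
      the form \<open>-1\<close>.\<close>
    have zero: "A i d = 0" if "a = 0" "i < d" for i
    proof (rule ccontr)
      assume nz: "A i d \<noteq> 0"
      have "0 \<le> A i i + 2 * x * A i d" for x
        using form[of "\<lambda>k. if k = i then 1 else 0" x] that
        by (simp add: q_def L_def a_def[symmetric] if_distrib[of "\<lambda>x. x * _"] if_distrib[of "\<lambda>x. _ * x"]
            cong: if_cong)
      from this[of "- (A i i + 1) / (2 * A i d)"] nz show False by (simp add: field_simps)
    qed
    \<comment> \<open>For \<open>a = 0\<close> division by 0 gives 0, so \<open>B\<close> is just
      \<open>A\<close>; the same convention makes the last column of \<open>Z'\<close> zero.\<close>
    define B where "B i j = A i j - A i d * A j d / a" for i j
    have "psd_matrix d B"
      unfolding psd_matrix_def sym_matrix_def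
    proof (intro conjI allI impI)
      show "B i j = B j i" if "i < d" "j < d" for i j
        using sym[of i j] that by (simp add: B_def)
      fix v :: "nat \<Rightarrow> real"
      have "(\<Sum>i<d. \<Sum>j<d. v i * (A i d * A j d / a) * v j) = (L v)\<^sup>2 / a"
        by (simp add: L_def power2_eq_square sum_product sum_divide_distrib mult_ac)
      then have "(\<Sum>i<d. \<Sum>j<d. v i * B i j * v j) = q v - (L v)\<^sup>2 / a"
        by (simp add: B_def q_def left_diff_distrib right_diff_distrib sum_subtractf)
      \<comment> \<open>For \<open>a > 0\<close> the value \<open>x = - L v / a\<close> minimises
        the form over the last coordinate.\<close>
      also have "\<dots> \<ge> 0"
        using form[of v "- L v / a"] form[of v 0]
        by (cases "a = 0") (simp_all add: a_def[symmetric] power2_eq_square field_simps)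
      finally show "0 \<le> (\<Sum>i<d. \<Sum>j<d. v i * B i j * v j)" .
    qed
    then obtain Z where Z: "\<And>i j. i < d \<Longrightarrow> j < d \<Longrightarrow> B i j = (\<Sum>k<d. Z i k * Z j k)"
      using Suc.IH by blast
    define Z' where "Z' i k = (if k < d then if i < d then Z i k else 0 else A i d / sqrt a)" for i k
    have "A i j = (\<Sum>k<Suc d. Z' i k * Z' j k)" if ij: "i < Suc d" "j < Suc d" for i j
    proof (cases "i < d \<and> j < d")
      case True
      then show ?thesis using Z[of i j] by (simp add: Z'_def B_def abs_of_nonneg[OF a])
    next
      case False
      then have "(\<Sum>k<Suc d. Z' i k * Z' j k) = A i d * A j d / a"
        by (auto simp: Z'_def abs_of_nonneg[OF a])
      also have "\<dots> = A i j"
        using False ij zero sym[of d j] zero[of i] zero[of j]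
        by (cases "a = 0") (auto simp: less_Suc_eq a_def[symmetric])
      finally show ?thesis by simp
    qed
    then show ?case by blast
  qed simp
  then show ?thesis using that by blast
qed

section \<open>Interpolation in finite-dimensional function spaces\<close>

text \<open>A Lagrange basis for the restrictions to \<open>B\<close>, built greedily. Its functions
  stay in \<open>V\<close>, so estimates for jets apply to them, while any combination of the
  \<open>w k\<close> enters only through its values at the nodes.\<close>

lemma interpolation_points:
  fixes w :: "'k \<Rightarrow> 'a \<Rightarrow> real"
  assumes "finite J" and w: "\<And>k. k \<in> J \<Longrightarrow> w k \<in> V"
    and add: "\<And>f g. f \<in> V \<Longrightarrow> g \<in> V \<Longrightarrow> (\<lambda>x. f x + g x) \<in> V"
    and scale: "\<And>f c. f \<in> V \<Longrightarrow> (\<lambda>x. c * f x) \<in> V"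
    and zero: "(\<lambda>x. 0) \<in> V"
  shows "\<exists>P e. finite P \<and> P \<subseteq> B \<and> (\<forall>b\<in>P. e b \<in> V) \<and>
    (\<forall>b\<in>P. \<forall>c\<in>P. e b c = (if b = c then 1 else 0)) \<and>
    (\<forall>k\<in>J. \<forall>x\<in>B. w k x = (\<Sum>b\<in>P. w k b * e b x))"
  using assms(1,2)
proof (induction J rule: finite_induct)
  case empty
  then show ?case by (intro exI[of _ "{}"]) auto
next
  case (insert j J)
  have "\<exists>P e. finite P \<and> P \<subseteq> B \<and> (\<forall>b\<in>P. e b \<in> V) \<and>
    (\<forall>b\<in>P. \<forall>c\<in>P. e b c = (if b = c then 1 else 0)) \<and>
    (\<forall>k\<in>J. \<forall>x\<in>B. w k x = (\<Sum>b\<in>P. w k b * e b x))"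
    by (intro insert.IH insert.prems) simp
  then obtain P e where Pe: "finite P \<and> P \<subseteq> B \<and> (\<forall>b\<in>P. e b \<in> V) \<and>
      (\<forall>b\<in>P. \<forall>c\<in>P. e b c = (if b = c then 1 else 0)) \<and>
      (\<forall>k\<in>J. \<forall>x\<in>B. w k x = (\<Sum>b\<in>P. w k b * e b x))"
    by (elim exE) (rule that)
  then have P: "finite P" "P \<subseteq> B" by blast+
  have e: "e b \<in> V" if "b \<in> P" for b using Pe that by blast
  have delta: "e b c = (if b = c then 1 else 0)" if "b \<in> P" "c \<in> P" for b c
    using Pe that by blast
  have interp: "w k x = (\<Sum>b\<in>P. w k b * e b x)" if "k \<in> J" "x \<in> B" for k x
    using Pe that by blast
  \<comment> \<open>\<open>r\<close> is the error of interpolating \<open>w j\<close>; a point of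
    \<open>B\<close> where it is nonzero becomes the next node.\<close>
  define r where "r x = w j x + (-1) * (\<Sum>b\<in>P. w j b * e b x)" for x
  have sum_V: "(\<lambda>x. \<Sum>b\<in>A. w j b * e b x) \<in> V" if "A \<subseteq> P" for A
    using finite_subset[OF that P(1)] that
    by (induction A rule: finite_induct) (auto intro!: add scale e zero)
  have r_V: "r \<in> V" unfolding r_def by (intro add scale sum_V insert.prems) auto
  have r_P: "r c = 0" if "c \<in> P" for c
  proof -
    have "(\<Sum>b\<in>P. w j b * e b c) = (\<Sum>b\<in>P. if b = c then w j b else 0)"
      by (intro sum.cong) (auto simp: delta that)
    then show ?thesis using that P(1) by (simp add: r_def)
  qed
  show ?case
  proof (cases "\<forall>x\<in>B. r x = 0")
    case True
    then have "\<forall>k\<in>insert j J. \<forall>x\<in>B. w k x = (\<Sum>b\<in>P. w k b * e b x)"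
      using interp by (auto simp: r_def)
    then show ?thesis using P e delta by (intro exI[of _ P] exI[of _ e] conjI ballI) blast+
  next
    case False
    then obtain z where z: "z \<in> B" "r z \<noteq> 0" by blast
    have "z \<notin> P" using r_P z by blast
    \<comment> \<open>The normalised error is the basis function of the new node \<open>z\<close>.
      The old ones are corrected by multiples of \<open>r\<close> to vanish at \<open>z\<close>,
      which changes nothing at the old nodes.\<close>
    define e' where "e' b x = (if b = z then (1 / r z) * r x else e b x + (- e b z / r z) * r x)" for b x
    have "finite (insert z P)" "insert z P \<subseteq> B" using P z by auto
    moreover have "e' b \<in> V" if "b \<in> insert z P" for b
    proof (cases "b = z")
      case True
      then have "e' b = (\<lambda>x. (1 / r z) * r x)" by (simp add: e'_def fun_eq_iff)
      then show ?thesis using scale[OF r_V] by (simp only:)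
    next
      case False
      then have "e' b = (\<lambda>x. e b x + (- e b z / r z) * r x)" by (simp add: e'_def fun_eq_iff)
      moreover have "b \<in> P" using False that by simp
      ultimately show ?thesis using add[OF e scale[OF r_V]] by (simp only:)
    qed
    moreover have "e' b c = (if b = c then 1 else 0)" if "b \<in> insert z P" "c \<in> insert z P" for b c
      using that \<open>z \<notin> P\<close> z(2) r_P delta by (auto simp: e'_def)
    moreover have "w k x = (\<Sum>b\<in>insert z P. w k b * e' b x)" if "k \<in> insert j J" "x \<in> B" for k x
    proof -
      have "(\<Sum>b\<in>P. w k b * e' b x) = (\<Sum>b\<in>P. w k b * e b x) - (\<Sum>b\<in>P. w k b * e b z) * (r x / r z)"
      proof -
        have "(\<Sum>b\<in>P. w k b * e' b x) = (\<Sum>b\<in>P. w k b * e b x - w k b * e b z * (r x / r z))"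
          using \<open>z \<notin> P\<close> by (intro sum.cong) (auto simp: e'_def algebra_simps)
        then show ?thesis by (simp only: sum_subtractf sum_distrib_right)
      qed
      then have "(\<Sum>b\<in>insert z P. w k b * e' b x)
          = (\<Sum>b\<in>P. w k b * e b x) + (w k z - (\<Sum>b\<in>P. w k b * e b z)) * (r x / r z)"
        using P(1) \<open>z \<notin> P\<close> by (simp add: e'_def algebra_simps)
      also have "\<dots> = w k x"
      proof (cases "k = j")
        case True
        then show ?thesis using z(2) by (simp add: r_def)
      next
        case False
        then have "k \<in> J" using that(1) by simp
        from interp[OF this z(1)] interp[OF this that(2)] show ?thesis by simp
      qed
      finally show ?thesis by simp
    qed
    ultimately show ?thesis
      by (intro exI[of _ "insert z P"] exI[of _ e'] conjI ballI)
  qed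
qed

section \<open>Robinson's form and a signed quadrature\<close>

text \<open>The left-hand side of Schur's inequality in degree three.\<close>

definition schur :: "real \<Rightarrow> real \<Rightarrow> real \<Rightarrow> real"
  where "schur a b c = a * (a - b) * (a - c) + b * (b - a) * (b - c) + c * (c - a) * (c - b)"

text \<open>By symmetry the arguments may be ordered, and then the expression is a sum of products
  of nonnegative factors.\<close>

lemma schur_nonneg:
  assumes "a \<ge> 0" "b \<ge> 0" "c \<ge> 0"
  shows "schur a b c \<ge> 0"
proof -
  have ord: "schur x y z \<ge> 0" if "x \<ge> y" "y \<ge> z" "z \<ge> 0" for x y z
  proof -
    have "schur x y z = (x - y) * ((x - y) * (x + y - z)) + z * ((x - z) * (y - z))"
      by (simp add: schur_def algebra_simps)
    also have "\<dots> \<ge> 0" using that by (intro add_nonneg_nonneg mult_nonneg_nonneg) auto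
    finally show ?thesis .
  qed
  have perm: "schur a b c = schur b a c" "schur a b c = schur a c b" "schur a b c = schur b c a"
    "schur a b c = schur c a b" "schur a b c = schur c b a"
    by (simp_all add: schur_def algebra_simps)
  show ?thesis
    using ord[of a b c] ord[of b a c] ord[of a c b] ord[of b c a] ord[of c a b] ord[of c b a] perm assms
    by linarith
qed

text \<open>Robinson's ternary sextic, with \<open>t\<close> as homogenising variable. For the grid
  of step \<open>t\<close> its value is \<open>t ^ 6\<close> at the origin and 0 at the eight other
  points.\<close>

definition robinson :: "real \<Rightarrow> real \<times> real \<Rightarrow> real"
  where "robinson t h = schur ((fst h)\<^sup>2) ((snd h)\<^sup>2) (t\<^sup>2)"

lemma robinson_nonneg: "robinson t h \<ge> 0"
  unfolding robinson_def by (intro schur_nonneg) auto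

text \<open>
  The coefficients of the Cayley--Bacharach relation on the grid \<open>{-t, 0, t}\<^sup>2\<close>: a cubic is
  determined at the centre by its values at the other eight points, which are the zeros of
  \<open>robinson t\<close>.
\<close>

definition mixed_diff :: "(real \<times> real \<Rightarrow> real) \<Rightarrow> real \<Rightarrow> real"
  where "mixed_diff u t = u (t, t) + u (t, - t) + u (- t, t) + u (- t, - t)
    - 2 * (u (t, 0) + u (- t, 0) + u (0, t) + u (0, - t)) + 4 * u (0, 0)"

lemma mixed_diff_sum: "mixed_diff (\<lambda>h. \<Sum>i\<in>A. f i h) t = (\<Sum>i\<in>A. mixed_diff (f i) t)"
  by (simp add: mixed_diff_def sum.distrib sum_subtractf sum_distrib_left)

lemma mixed_diff_scale: "mixed_diff (\<lambda>h. c * u h) t = c * mixed_diff u t"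
  by (simp add: mixed_diff_def algebra_simps)

lemma bigo_cmult: "f \<in> O[F](g) \<Longrightarrow> (\<lambda>x. c * f x :: real) \<in> O[F](g)"
  by (cases "c = 0") simp_all

text \<open>On a monomial \<open>mixed_diff\<close> is the product of two second central
  differences. Each is 0 for the exponents 0 and 1 (with \<open>0 ^ 0 = 1\<close>) and at most
  \<open>2 * t\<^sup>2\<close> in size for the others.\<close>

lemma mixed_diff_monomial_bigo:
  "(\<lambda>t. mixed_diff (\<lambda>h. fst h ^ i * snd h ^ j) t) \<in> O[at_right 0](\<lambda>t. t ^ 4)"
proof -
  have eq: "mixed_diff (\<lambda>h. fst h ^ i * snd h ^ j) t
      = (t ^ i + (- t) ^ i - 2 * 0 ^ i) * (t ^ j + (- t) ^ j - 2 * 0 ^ j)" for t :: real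
    by (simp add: mixed_diff_def algebra_simps)
  have bound: "\<bar>t ^ i + (- t) ^ i - 2 * 0 ^ i\<bar> \<le> 2 * t\<^sup>2" if "0 < t" "t < 1" for t :: real and i
  proof (cases "i \<ge> 2")
    case True
    then have "t ^ i \<le> t\<^sup>2" using that by (intro power_decreasing) auto
    then show ?thesis using True that by (cases "even i") (auto simp: power_0_left)
  next
    case False
    then consider "i = 0" | "i = 1" by linarith
    then show ?thesis by cases auto
  qed
  have "\<forall>\<^sub>F t :: real in at_right 0. 0 < t \<and> t < 1"
    using eventually_at_right_real[of 0 1] by simp
  then have "\<forall>\<^sub>F t :: real in at_right 0. norm (mixed_diff (\<lambda>h. fst h ^ i * snd h ^ j) t) \<le> 4 * norm (t ^ 4)"
  proof eventually_elim
    case (elim t)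
    have "norm (mixed_diff (\<lambda>h. fst h ^ i * snd h ^ j) t) \<le> (2 * t\<^sup>2) * (2 * t\<^sup>2)"
      unfolding eq real_norm_def abs_mult using elim bound[of t] by (intro mult_mono) auto
    then show ?case by (simp add: power2_eq_square power4_eq_xxxx abs_mult)
  qed
  then show ?thesis by (rule bigoI)
qed

lemma jet_mixed_diff_bigo:
  assumes "u \<in> jet"
  shows "mixed_diff u \<in> O[at_right 0](\<lambda>t. t ^ 4)"
proof -
  obtain p where p: "(\<lambda>h. u h - bipoly p h) \<in> O[nhds 0](\<lambda>h. norm h ^ 4)"
    using assms by (rule jetE)
  define r where "r h = u h - bipoly p h" for h
  have r: "(\<lambda>t. r (t * a, t * b)) \<in> O[at_right 0](\<lambda>t. t ^ 4)" for a b
  proof -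
    have "((\<lambda>t :: real. (t * a, t * b)) \<longlongrightarrow> (0 * a, 0 * b)) (at_right 0)"
      by (intro tendsto_intros)
    then have "((\<lambda>t :: real. (t * a, t * b)) \<longlongrightarrow> 0) (at_right 0)" by (simp add: zero_prod_def)
    then have "(\<lambda>t. r (t * a, t * b)) \<in> O[at_right 0](\<lambda>t. norm (t * a, t * b) ^ 4)"
      using landau_o.big.compose[OF p] unfolding r_def by blast
    also have "(\<lambda>t. norm (t * a, t * b) ^ 4) \<in> O[at_right 0](\<lambda>t. t ^ 4)"
    proof (rule bigoI[of _ "norm (a, b) ^ 4"], rule always_eventually, rule allI)
      fix t :: real
      have "norm (t * a, t * b) = \<bar>t\<bar> * norm (a, b)" using norm_scaleR[of t "(a, b)"] by simp
      then show "norm (norm (t * a, t * b) ^ 4) \<le> norm (a, b) ^ 4 * norm (t ^ 4)"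
        by (simp add: power_mult_distrib power_abs mult.commute)
    qed
    finally show ?thesis .
  qed
  have "mixed_diff r \<in> O[at_right 0](\<lambda>t. t ^ 4)"
    unfolding mixed_diff_def[abs_def]
    using r[of 1 1] r[of 1 "-1"] r[of "-1" 1] r[of "-1" "-1"] r[of 1 0] r[of "-1" 0] r[of 0 1] r[of 0 "-1"] r[of 0 0]
    by (intro sum_in_bigo bigo_cmult) simp_all
  moreover have "mixed_diff (bipoly p) \<in> O[at_right 0](\<lambda>t. t ^ 4)"
    unfolding bipoly_expand[abs_def] mixed_diff_sum[abs_def] mixed_diff_scale
    by (intro big_sum_in_bigo bigo_cmult mixed_diff_monomial_bigo)
  ultimately have "(\<lambda>t. mixed_diff r t + mixed_diff (bipoly p) t) \<in> O[at_right 0](\<lambda>t. t ^ 4)"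
    by (rule sum_in_bigo(1))
  then show ?thesis by (simp add: r_def mixed_diff_def[abs_def] algebra_simps)
qed

text \<open>Cauchy-Schwarz for \<open>4 * u (0, 0)\<close>, written in terms of
  \<open>mixed_diff u t\<close> and the eight other values. The coefficients are once 1, four times
  -1 and four times 2, with sum of squares 21.\<close>

lemma mixed_diff_square_bound:
  "16 * (u (0, 0))\<^sup>2 \<le> 21 * ((u (t, t))\<^sup>2 + (u (t, - t))\<^sup>2 + (u (- t, t))\<^sup>2 + (u (- t, - t))\<^sup>2
    + (u (t, 0))\<^sup>2 + (u (- t, 0))\<^sup>2 + (u (0, t))\<^sup>2 + (u (0, - t))\<^sup>2 + (mixed_diff u t)\<^sup>2)"
proof -
  define a where "a = (\<lambda>i. [1, -1, -1, -1, -1, 2, 2, 2, 2 :: real] ! i)"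
  define b where "b = (\<lambda>i. [mixed_diff u t, u (t, t), u (t, - t), u (- t, t), u (- t, - t),
    u (t, 0), u (- t, 0), u (0, t), u (0, - t)] ! i)"
  have nine: "(\<Sum>i<9. f i) = f 0 + f 1 + f 2 + f 3 + f 4 + f 5 + f 6 + f 7 + f (8::nat)" for f :: "nat \<Rightarrow> real"
    by (simp add: eval_nat_numeral)
  have "(\<Sum>i<9. a i * b i) = 4 * u (0, 0)"
    unfolding nine by (simp add: a_def b_def mixed_diff_def)
  moreover have "(\<Sum>i<9. (a i)\<^sup>2) = 21" unfolding nine by (simp add: a_def)
  moreover have "(\<Sum>i<9. (b i)\<^sup>2) = (u (t, t))\<^sup>2 + (u (t, - t))\<^sup>2 + (u (- t, t))\<^sup>2 + (u (- t, - t))\<^sup>2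
    + (u (t, 0))\<^sup>2 + (u (- t, 0))\<^sup>2 + (u (0, t))\<^sup>2 + (u (0, - t))\<^sup>2 + (mixed_diff u t)\<^sup>2"
    unfolding nine by (simp add: b_def)
  moreover have "(4 * u (0, 0))\<^sup>2 = 16 * (u (0, 0))\<^sup>2" by (simp add: power_mult_distrib)
  ultimately show ?thesis using Cauchy_Schwarz_ineq_sum[of a b "{..<9}"] by simp
qed

text \<open>The weights are 21 at the outer grid points and -16 at the centre. On a square of
  \<open>u\<close> the defect is at most \<open>21 * (mixed_diff u t)\<^sup>2\<close>, which weights
  \<open>21 * \<kappa> t\<close> at the interpolation nodes absorb. As \<open>\<kappa>\<close> has
  order \<open>t ^ 8\<close>, they cannot outweigh the value \<open>-16 * t ^ 6\<close> at
  Robinson's form.\<close>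

lemma signed_quadrature:
  fixes w :: "'k \<Rightarrow> real \<times> real \<Rightarrow> real"
  assumes J: "finite J" "\<And>k. k \<in> J \<Longrightarrow> w k \<in> jet" and B: "\<forall>\<^sub>F h in nhds 0. h \<in> B"
  obtains n t and l :: "nat \<Rightarrow> real" and x :: "nat \<Rightarrow> real \<times> real"
  where "\<forall>i<n. x i \<in> B" "0 < (\<Sum>i<n. l i)"
    "\<forall>\<gamma>. 0 \<le> (\<Sum>i<n. l i * (\<Sum>k\<in>J. \<gamma> k * w k (x i))\<^sup>2)"
    "(\<Sum>i<n. l i * robinson t (x i)) < 0"
proof -
  have "\<exists>P e. finite P \<and> P \<subseteq> B \<and> (\<forall>b\<in>P. e b \<in> jet) \<and>
      (\<forall>b\<in>P. \<forall>c\<in>P. e b c = (if b = c then 1 else 0)) \<and>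
      (\<forall>k\<in>J. \<forall>x\<in>B. w k x = (\<Sum>b\<in>P. w k b * e b x))"
    proof (rule interpolation_points[OF J])
      show "(\<lambda>x. f x + g x) \<in> jet" if "f \<in> jet" "g \<in> jet" for f g by (rule jet_add[OF that])
      show "(\<lambda>x. c * f x) \<in> jet" if "f \<in> jet" for f c by (rule jet_mult[OF jet_const that])
    qed (rule jet_const | assumption)+
  then obtain P e where Pe: "finite P \<and> P \<subseteq> B \<and> (\<forall>b\<in>P. e b \<in> jet) \<and>
      (\<forall>b\<in>P. \<forall>c\<in>P. e b c = (if b = c then 1 else 0)) \<and>
      (\<forall>k\<in>J. \<forall>x\<in>B. w k x = (\<Sum>b\<in>P. w k b * e b x))"
    by (elim exE) (rule that)
  then have P: "finite P" "P \<subseteq> B" by blast+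
  have e: "e b \<in> jet" if "b \<in> P" for b using Pe that by blast
  have interp: "w k x = (\<Sum>b\<in>P. w k b * e b x)" if "k \<in> J" "x \<in> B" for k x
    using Pe that by blast
  define \<kappa> where "\<kappa> t = (\<Sum>b\<in>P. (mixed_diff (e b) t)\<^sup>2)" for t
  have "\<kappa> \<in> O[at_right 0](\<lambda>t. t ^ 8)"
    unfolding \<kappa>_def
  proof (intro big_sum_in_bigo)
    fix b assume "b \<in> P"
    have "(\<lambda>t. mixed_diff (e b) t * mixed_diff (e b) t) \<in> O[at_right 0](\<lambda>t. t ^ 4 * t ^ 4)"
      by (intro landau_o.big.mult jet_mixed_diff_bigo e \<open>b \<in> P\<close>)
    then show "(\<lambda>t. (mixed_diff (e b) t)\<^sup>2) \<in> O[at_right 0](\<lambda>t. t ^ 8)"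
      by (simp add: power2_eq_square flip: power_add)
  qed
  moreover have "(\<lambda>t. \<Sum>b\<in>P. robinson t b) \<in> O[at_right 0](\<lambda>_. 1)"
  proof (rule bigoI_tendsto)
    show "((\<lambda>t. (\<Sum>b\<in>P. robinson t b) / 1) \<longlongrightarrow> (\<Sum>b\<in>P. robinson 0 b) / 1) (at_right 0)"
      unfolding robinson_def schur_def by (intro tendsto_intros) auto
  qed simp
  ultimately have "(\<lambda>t. \<kappa> t * (\<Sum>b\<in>P. robinson t b)) \<in> O[at_right 0](\<lambda>t. t ^ 8 * 1)"
    by (rule landau_o.big.mult)
  also have "(\<lambda>t :: real. t ^ 8 * 1) \<in> o[at_right 0](\<lambda>t. t ^ 6)"
  proof (rule smalloI_tendsto)
    have lim: "((\<lambda>t :: real. t\<^sup>2) \<longlongrightarrow> 0\<^sup>2) (at_right 0)" by (intro tendsto_intros)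
    have eq: "\<forall>\<^sub>F t :: real in at_right 0. t\<^sup>2 = t ^ 8 * 1 / t ^ 6"
      using eventually_at_right_less[of "0::real"]
      by eventually_elim (simp add: field_simps flip: power_add)
    show "((\<lambda>t :: real. t ^ 8 * 1 / t ^ 6) \<longlongrightarrow> 0) (at_right 0)"
      using Lim_transform_eventually[OF lim eq] by simp
    show "\<forall>\<^sub>F t :: real in at_right 0. t ^ 6 \<noteq> 0"
      using eventually_at_right_less[of "0::real"] by eventually_elim simp
  qed
  \<comment> \<open>The factor \<open>1/2\<close> suffices because \<open>21/2 < 16\<close>.\<close>
  finally have small: "\<forall>\<^sub>F t in at_right 0. norm (\<kappa> t * (\<Sum>b\<in>P. robinson t b)) \<le> 1/2 * norm (t ^ 6)"
    by (rule landau_o.smallD) simp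
  have in_B: "\<forall>\<^sub>F t in at_right 0. (t * a, t * b) \<in> B" for a b
  proof -
    have "((\<lambda>t :: real. (t * a, t * b)) \<longlongrightarrow> (0 * a, 0 * b)) (at_right 0)"
      by (intro tendsto_intros)
    then have "((\<lambda>t :: real. (t * a, t * b)) \<longlongrightarrow> 0) (at_right 0)" by (simp add: zero_prod_def)
    then show ?thesis by (rule eventually_compose_filterlim[OF B])
  qed
  have "\<forall>\<^sub>F t in at_right 0. t > 0 \<and> norm (\<kappa> t * (\<Sum>b\<in>P. robinson t b)) \<le> 1/2 * norm (t ^ 6) \<and>
      (t, t) \<in> B \<and> (t, - t) \<in> B \<and> (- t, t) \<in> B \<and> (- t, - t) \<in> B \<and>
      (t, 0) \<in> B \<and> (- t, 0) \<in> B \<and> (0, t) \<in> B \<and> (0, - t) \<in> B \<and> (0, 0) \<in> B"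
    using eventually_at_right_less[of "0::real"] small
      in_B[of 1 1] in_B[of 1 "-1"] in_B[of "-1" 1] in_B[of "-1" "-1"]
      in_B[of 1 0] in_B[of "-1" 0] in_B[of 0 1] in_B[of 0 "-1"] in_B[of 0 0]
    by (simp add: eventually_conj_iff)
  then obtain t where "t > 0" and t_small: "norm (\<kappa> t * (\<Sum>b\<in>P. robinson t b)) \<le> 1/2 * norm (t ^ 6)"
    and grid: "(t, t) \<in> B" "(t, - t) \<in> B" "(- t, t) \<in> B" "(- t, - t) \<in> B"
      "(t, 0) \<in> B" "(- t, 0) \<in> B" "(0, t) \<in> B" "(0, - t) \<in> B" "(0, 0) \<in> B"
    using eventually_happens'[of "at_right (0::real)"] by auto
  have \<kappa>: "\<kappa> t \<ge> 0" unfolding \<kappa>_def by (intro sum_nonneg) simp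
  obtain bs where bs: "set bs = P" "distinct bs" using finite_distinct_list[OF P(1)] by blast
  \<comment> \<open>A list of weighted points, since the interpolation nodes may coincide with grid
    points and the weights then add up.\<close>
  define L where "L = [(21, (t, t)), (21, (t, - t)), (21, (- t, t)), (21, (- t, - t)),
    (21, (t, 0)), (21, (- t, 0)), (21, (0, t)), (21, (0, - t)), (- 16, (0, 0))]
    @ map (\<lambda>b. (21 * \<kappa> t, b)) bs"
  have sum_L: "(\<Sum>i<length L. fst (L ! i) * g (snd (L ! i)))
      = 21 * (g (t, t) + g (t, - t) + g (- t, t) + g (- t, - t) + g (t, 0) + g (- t, 0) + g (0, t) + g (0, - t))
        - 16 * g (0, 0) + 21 * \<kappa> t * (\<Sum>b\<in>P. g b)" for g :: "real \<times> real \<Rightarrow> real"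
  proof -
    have "(\<Sum>i<length L. fst (L ! i) * g (snd (L ! i))) = (\<Sum>p\<leftarrow>L. fst p * g (snd p))"
      by (simp add: sum_list_sum_nth atLeast0LessThan)
    moreover have "(\<Sum>b\<leftarrow>bs. 21 * \<kappa> t * g b) = 21 * \<kappa> t * (\<Sum>b\<in>P. g b)"
      using bs by (simp add: sum_list_const_mult sum_list_distinct_conv_sum_set)
    ultimately show ?thesis by (simp add: L_def o_def)
  qed
  show ?thesis
  proof
    have "\<forall>p\<in>set L. snd p \<in> B" using grid P(2) bs(1) by (auto simp: L_def)
    then show "\<forall>i<length L. snd (L ! i) \<in> B" by simp
    show "0 < (\<Sum>i<length L. fst (L ! i))"
      using sum_L[of "\<lambda>_. 1"] \<kappa> by (simp add: add_pos_nonneg)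
    show "(\<Sum>i<length L. fst (L ! i) * robinson t (snd (L ! i))) < 0"
    proof -
      define R where "R = \<kappa> t * (\<Sum>b\<in>P. robinson t b)"
      have "R \<le> 1/2 * t ^ 6" using t_small \<open>t > 0\<close> by (simp add: R_def)
      moreover have "t ^ 6 > 0" using \<open>t > 0\<close> by simp
      moreover have "(\<Sum>i<length L. fst (L ! i) * robinson t (snd (L ! i))) = 21 * R - 16 * t ^ 6"
        unfolding sum_L by (simp add: R_def) (simp add: robinson_def schur_def flip: power_add)
      ultimately show ?thesis by linarith
    qed
    have "0 \<le> (\<Sum>i<length L. fst (L ! i) * (\<Sum>k\<in>J. \<gamma> k * w k (snd (L ! i)))\<^sup>2)" for \<gamma>
    proof -
      define u where "u h = (\<Sum>k\<in>J. \<gamma> k * w k h)" for h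
      have u: "u h = (\<Sum>b\<in>P. u b * e b h)" if "h \<in> B" for h
      proof -
        have "u h = (\<Sum>k\<in>J. \<Sum>b\<in>P. \<gamma> k * w k b * e b h)"
          unfolding u_def using interp[OF _ that] by (simp add: sum_distrib_left mult_ac)
        also have "\<dots> = (\<Sum>b\<in>P. \<Sum>k\<in>J. \<gamma> k * w k b * e b h)" by (rule sum.swap)
        finally show ?thesis by (simp add: u_def sum_distrib_right)
      qed
      \<comment> \<open>All nine grid points lie in \<open>B\<close>, so \<open>u\<close> may be
        replaced by its interpolant inside \<open>mixed_diff\<close>.\<close>
      have "mixed_diff u t = mixed_diff (\<lambda>h. \<Sum>b\<in>P. u b * e b h) t"
        unfolding mixed_diff_def
        by (simp only: u[OF grid(1), symmetric] u[OF grid(2), symmetric] u[OF grid(3), symmetric]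
            u[OF grid(4), symmetric] u[OF grid(5), symmetric] u[OF grid(6), symmetric]
            u[OF grid(7), symmetric] u[OF grid(8), symmetric] u[OF grid(9), symmetric])
      also have "\<dots> = (\<Sum>b\<in>P. u b * mixed_diff (e b) t)"
        by (simp only: mixed_diff_sum mixed_diff_scale)
      finally have "(mixed_diff u t)\<^sup>2 \<le> (\<Sum>b\<in>P. (u b)\<^sup>2) * \<kappa> t"
        unfolding \<kappa>_def by (simp only: Cauchy_Schwarz_ineq_sum)
      moreover define R where "R = (\<Sum>b\<in>P. (u b)\<^sup>2) * \<kappa> t"
      ultimately have R: "(mixed_diff u t)\<^sup>2 \<le> R" by simp
      have eq: "(\<Sum>i<length L. fst (L ! i) * (u (snd (L ! i)))\<^sup>2)
        = 21 * ((u (t, t))\<^sup>2 + (u (t, - t))\<^sup>2 + (u (- t, t))\<^sup>2 + (u (- t, - t))\<^sup>2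
          + (u (t, 0))\<^sup>2 + (u (- t, 0))\<^sup>2 + (u (0, t))\<^sup>2 + (u (0, - t))\<^sup>2) - 16 * (u (0, 0))\<^sup>2 + 21 * R"
        unfolding sum_L[of "\<lambda>h. (u h)\<^sup>2"] R_def by (simp only: mult_ac)
      have "0 \<le> 21 * g - 16 * z + 21 * R" if "16 * z \<le> 21 * (g + y)" "y \<le> R" for g z y :: real
        using that by (simp add: algebra_simps)
      from this[OF mixed_diff_square_bound R]
      have "0 \<le> (\<Sum>i<length L. fst (L ! i) * (u (snd (L ! i)))\<^sup>2)" unfolding eq .
      then show ?thesis
        by (simp add: u_def)
    qed
    then show "\<forall>\<gamma>. 0 \<le> (\<Sum>i<length L. fst (L ! i) * (\<Sum>k\<in>J. \<gamma> k * w k (snd (L ! i)))\<^sup>2)" by (rule allI)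
  qed
qed

section \<open>The closed convex hull of a monomial map\<close>

text \<open>Stating that membership depends only on the signs of finitely many polynomials avoids a
  normal form: complements keep the same polynomials and unions merge them.\<close>

lemma semialgebraic_signs:
  assumes "semialgebraic A"
  shows "\<exists>\<Phi>. finite \<Phi> \<and> (\<forall>f\<in>\<Phi>. real_polynomial_function f) \<and>
    (\<forall>x y. (\<forall>f\<in>\<Phi>. f x > 0 \<longleftrightarrow> f y > 0) \<longrightarrow> (x \<in> A \<longleftrightarrow> y \<in> A))"
  using assms
proof (induction rule: semialgebraic.induct)
  case (pos f)
  then show ?case by (intro exI[of _ "{f}"]) simp
next
  case (compl A)
  then show ?case by simp
next
  case (union A B)
  then obtain \<Phi> \<Psi> where \<Phi>: "finite \<Phi> \<and> (\<forall>f\<in>\<Phi>. real_polynomial_function f) \<and>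
    (\<forall>x y. (\<forall>f\<in>\<Phi>. f x > 0 \<longleftrightarrow> f y > 0) \<longrightarrow> (x \<in> A \<longleftrightarrow> y \<in> A))"
    and \<Psi>: "finite \<Psi> \<and> (\<forall>f\<in>\<Psi>. real_polynomial_function f) \<and>
    (\<forall>x y. (\<forall>f\<in>\<Psi>. f x > 0 \<longleftrightarrow> f y > 0) \<longrightarrow> (x \<in> B \<longleftrightarrow> y \<in> B))"
    by (elim exE) (rule that)
  show ?case
  proof (intro exI[of _ "\<Phi> \<union> \<Psi>"] conjI allI impI)
    fix x y assume sgn: "\<forall>f\<in>\<Phi> \<union> \<Psi>. f x > 0 \<longleftrightarrow> f y > 0"
    have "x \<in> A \<longleftrightarrow> y \<in> A" using \<Phi> sgn by blast
    moreover have "x \<in> B \<longleftrightarrow> y \<in> B" using \<Psi> sgn by blast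
    ultimately show "x \<in> A \<union> B \<longleftrightarrow> y \<in> A \<union> B" by simp
  qed (use \<Phi> \<Psi> in auto)
qed

text \<open>The span of the 49 monomials of degree at most 6 in each variable, with the pair of
  exponents encoded in base 7. It is stable under translations of the plane.\<close>

definition bidegree6 :: "(real \<Rightarrow> real \<Rightarrow> real) set"
  where "bidegree6 = {g. \<exists>c. \<forall>A B. g A B = (\<Sum>n<49. c n * (A ^ (n div 7) * B ^ (n mod 7)))}"

lemma bidegree6_add:
  "f \<in> bidegree6 \<Longrightarrow> g \<in> bidegree6 \<Longrightarrow> (\<lambda>A B. f A B + g A B) \<in> bidegree6"
proof -
  assume "f \<in> bidegree6" "g \<in> bidegree6"
  then obtain c d where "\<And>A B. f A B = (\<Sum>n<49. c n * (A ^ (n div 7) * B ^ (n mod 7)))"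
    "\<And>A B. g A B = (\<Sum>n<49. d n * (A ^ (n div 7) * B ^ (n mod 7)))"
    unfolding bidegree6_def by blast
  then show ?thesis unfolding bidegree6_def
    by (intro CollectI exI[of _ "\<lambda>n. c n + d n"]) (simp add: distrib_right sum.distrib)
qed

lemma bidegree6_scale:
  "f \<in> bidegree6 \<Longrightarrow> (\<lambda>A B. r * f A B) \<in> bidegree6"
proof -
  assume "f \<in> bidegree6"
  then obtain c where "\<And>A B. f A B = (\<Sum>n<49. c n * (A ^ (n div 7) * B ^ (n mod 7)))"
    unfolding bidegree6_def by blast
  then show ?thesis unfolding bidegree6_def
    by (intro CollectI exI[of _ "\<lambda>n. r * c n"]) (simp add: sum_distrib_left mult_ac)
qed

lemma bidegree6_shifted_monomial:
  assumes "i \<le> 6" "j \<le> 6"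
  shows "(\<lambda>A B. (A - s) ^ i * (B - t) ^ j) \<in> bidegree6"
proof -
  have expand: "(A - s) ^ i = (\<Sum>k<7. coeff ([:- s, 1:] ^ i) k * A ^ k)" if "i \<le> 6" for A s :: real and i
  proof -
    have "(A - s) ^ i = poly ([:- s, 1:] ^ i) A" by (simp add: poly_power)
    also have "\<dots> = (\<Sum>k\<le>i. coeff ([:- s, 1:] ^ i) k * A ^ k)"
      by (simp add: poly_altdef degree_linear_power)
    also have "\<dots> = (\<Sum>k<7. coeff ([:- s, 1:] ^ i) k * A ^ k)"
      using that by (intro sum.mono_neutral_left) (auto simp: coeff_eq_0 degree_linear_power)
    finally show ?thesis .
  qed
  define c where "c n = coeff ([:- s, 1:] ^ i) (n div 7) * coeff ([:- t, 1:] ^ j) (n mod 7)" for n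
  have "(A - s) ^ i * (B - t) ^ j = (\<Sum>n<49. c n * (A ^ (n div 7) * B ^ (n mod 7)))" for A B
  proof -
    have "(A - s) ^ i * (B - t) ^ j
        = (\<Sum>(k, l)\<in>{..<7}\<times>{..<7}. (coeff ([:- s, 1:] ^ i) k * A ^ k) * (coeff ([:- t, 1:] ^ j) l * B ^ l))"
      unfolding expand[OF assms(1)] expand[OF assms(2)] sum_product by (rule sum.cartesian_product)
    also have "\<dots> = (\<Sum>n<49. c n * (A ^ (n div 7) * B ^ (n mod 7)))"
      by (rule sum.reindex_bij_witness[of _ "\<lambda>n. (n div 7, n mod 7)" "\<lambda>(k, l). 7 * k + l"])
        (auto simp: c_def)
    finally show ?thesis .
  qed
  then show ?thesis unfolding bidegree6_def by blast
qed

lemma bidegree6_robinson: "(\<lambda>A B. robinson t (A - s1, B - s2)) \<in> bidegree6"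
proof -
  let ?m = "\<lambda>i j A B. (A - s1) ^ i * (B - s2) ^ j"
  \<comment> \<open>The ten monomials of Robinson's form, evaluated at the shifted
    arguments.\<close>
  have "(\<lambda>A B. 1 * ?m 6 0 A B + (1 * ?m 0 6 A B + (t ^ 6 * ?m 0 0 A B + ((-1) * ?m 4 2 A B
      + ((- (t\<^sup>2)) * ?m 4 0 A B + ((-1) * ?m 2 4 A B + ((- (t\<^sup>2)) * ?m 0 4 A B
      + ((- (t ^ 4)) * ?m 2 0 A B + ((- (t ^ 4)) * ?m 0 2 A B + (3 * t\<^sup>2) * ?m 2 2 A B))))))))) \<in> bidegree6"
    by (intro bidegree6_add bidegree6_scale bidegree6_shifted_monomial) simp_all
  moreover have "robinson t (A - s1, B - s2) = 1 * ?m 6 0 A B + (1 * ?m 0 6 A B + (t ^ 6 * ?m 0 0 A B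
      + ((-1) * ?m 4 2 A B + ((- (t\<^sup>2)) * ?m 4 0 A B + ((-1) * ?m 2 4 A B + ((- (t\<^sup>2)) * ?m 0 4 A B
      + ((- (t ^ 4)) * ?m 2 0 A B + ((- (t ^ 4)) * ?m 0 2 A B + (3 * t\<^sup>2) * ?m 2 2 A B))))))))" for A B
  proof -
    define x y where "x = A - s1" and "y = B - s2"
    show ?thesis unfolding robinson_def schur_def fst_conv snd_conv x_def[symmetric] y_def[symmetric]
      by (simp add: algebra_simps eval_nat_numeral)
  qed
  ultimately show ?thesis by (simp only:)
qed

section \<open>Half-spaces and closed convex hulls\<close>

lemma sum_fun_apply: "(\<Sum>i\<in>A. f i) x = (\<Sum>i\<in>A. f i x)"
  for f :: "'i \<Rightarrow> 'a \<Rightarrow> 'b::comm_monoid_add"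
  by (induction A rule: infinite_finite_induct) auto

lemma closure_convex_hull_halfspace:
  assumes "\<And>x. x \<in> D \<Longrightarrow> x \<in> Rn k" "\<And>x. x \<in> D \<Longrightarrow> 0 \<le> (\<Sum>n<k. c n * x n)"
    and y: "y \<in> Euclidean_space k closure_of (convex hull D)"
  shows "0 \<le> (\<Sum>n<k. c n * y n)"
proof -
  define H where "H = Rn k \<inter> {x. 0 \<le> (\<Sum>n<k. c n * x n)}"
  have "convex H"
    unfolding convex_def H_def topspace_Euclidean_space
    by (auto simp: scaleR_fun_def distrib_left sum.distrib mult.left_commute[of "c _"]
        simp flip: sum_distrib_left intro!: add_nonneg_nonneg mult_nonneg_nonneg)
  then have "convex hull D \<subseteq> H" using assms(1,2) by (intro hull_minimal) (auto simp: H_def)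
  moreover have "closedin (Euclidean_space k) H"
  proof -
    have "continuous_on UNIV (\<lambda>x :: nat \<Rightarrow> real. \<Sum>n<k. c n * x n)"
      by (intro continuous_intros continuous_on_product_coordinates)
    then have "closed {x :: nat \<Rightarrow> real. 0 \<le> (\<Sum>n<k. c n * x n)}"
      by (intro closed_Collect_le continuous_on_const)
    moreover have "closed (Rn k)" by (rule closedin_Euclidean_imp_closed[OF closedin_topspace])
    ultimately show ?thesis unfolding closedin_Euclidean_space_iff H_def by auto
  qed
  ultimately have "Euclidean_space k closure_of (convex hull D) \<subseteq> H" by (rule closure_of_minimal)
  then show ?thesis using y by (auto simp: H_def)
qed

lemma in_closure_convex_hull:
  assumes "\<And>x. x \<in> D \<Longrightarrow> x \<in> Rn k" "y \<in> D"
  shows "y \<in> Euclidean_space k closure_of (convex hull D)"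
proof -
  have "convex (Rn k)" unfolding convex_def topspace_Euclidean_space by (auto simp: scaleR_fun_def)
  then have "convex hull D \<subseteq> Rn k" using assms(1) by (intro hull_minimal) auto
  then show ?thesis using closure_of_subset hull_inc[OF assms(2), of convex] by blast
qed

text \<open>
  The coordinates of the space containing \<open>X\<close>: the values of \<open>a\<close> and \<open>b\<close>, a point of \<open>S\<close>, its lift
  to the spectrahedron, and the entries of a factor \<open>Z\<close>.
\<close>

datatype 'm coord = Base bool | Point 'm | Lift nat | Factor nat nat

lemma mpoly_fun_Point:
  fixes f :: "real ^ 'm \<Rightarrow> real"
  assumes "real_polynomial_function f"
  shows "(\<lambda>v. f (\<chi> j. v (Point j))) \<in> mpoly_fun (range Point)"
  using assms
proof (induction rule: real_polynomial_function.induct)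
  case (linear f)
  then have "linear f" by (rule bounded_linear.linear)
  have "f (\<chi> j. v (Point j)) = (\<Sum>j\<in>UNIV. v (Point j) * f (axis j 1))" for v
  proof -
    have "(\<chi> j. v (Point j)) = (\<Sum>j\<in>UNIV. v (Point j) *\<^sub>R (axis j 1 :: real ^ 'm))"
      using basis_expansion[of "\<chi> j. v (Point j)"] by (simp add: scalar_mult_eq_scaleR)
    then show ?thesis
      by (simp add: linear_sum[OF \<open>linear f\<close>] linear_cmul[OF \<open>linear f\<close>])
  qed
  then show ?case by (auto intro!: mpoly_fun_sum mpoly_fun.intros)
qed (auto intro: mpoly_fun.intros)

text \<open>The centre and the scale of Robinson's form depend on the supposed spectrahedron,
  whereas \<open>\<phi>\<close> must be fixed before it. All 49 monomials are taken so that every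
  translate and scaling of the form is linear in the coordinates of \<open>\<phi>\<close>.\<close>

lemma not_shadow_monomial_map:
  fixes S :: "(real ^ 'm) set"
  assumes S: "semialgebraic S" and a: "real_polynomial_function a" and b: "real_polynomial_function b"
    and indep: "\<forall>q\<in>mpoly_fun {Base True :: 'm coord, Base False}.
      (\<forall>x\<in>S. q (\<lambda>i. if i = Base True then a x else b x) = 0) \<longrightarrow> (\<forall>v. q v = 0)"
  defines "\<phi> \<equiv> \<lambda>x n. if n < 49 then a x ^ (n div 7) * b x ^ (n mod 7) else 0"
  shows "\<not> spectrahedral_shadow 49 (Euclidean_space 49 closure_of (convex hull (\<phi> ` S)))"
proof
  define K where "K = Euclidean_space 49 closure_of (convex hull (\<phi> ` S))"
  assume "spectrahedral_shadow 49 (Euclidean_space 49 closure_of (convex hull (\<phi> ` S)))"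
  then obtain N T f where "spectrahedron N T" and f: "linear f" and K: "K = f ` T"
    unfolding spectrahedral_shadow_def K_def[symmetric] by blast
  then obtain d M0 M where M0: "sym_matrix d M0" and M: "\<And>l. l < N \<Longrightarrow> sym_matrix d (M l)"
    and T: "T = {\<xi> \<in> Rn N. psd_matrix d (\<lambda>i j. M0 i j + (\<Sum>l<N. \<xi> l * M l i j))}"
    unfolding spectrahedron_def by blast
  define mat where "mat \<xi> i j = M0 i j + (\<Sum>l<N. \<xi> l * M l i j)" for \<xi> i j
  have T_iff: "\<xi> \<in> T \<longleftrightarrow> \<xi> \<in> Rn N \<and> psd_matrix d (mat \<xi>)" for \<xi>
    by (simp add: T mat_def[abs_def])
  have \<phi>_Rn: "y \<in> Rn 49" if "y \<in> \<phi> ` S" for y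
    using that by (auto simp: \<phi>_def topspace_Euclidean_space)

  \<comment> \<open>The semi-algebraic set of lifted and factored points\<close>
  define pt :: "('m coord \<Rightarrow> real) \<Rightarrow> real ^ 'm" where "pt v = (\<chi> j. v (Point j))" for v
  define xi :: "('m coord \<Rightarrow> real) \<Rightarrow> nat \<Rightarrow> real"
    where "xi v = (\<lambda>l. if l < N then v (Lift l) else 0)" for v
  define F where "F l n = f (\<lambda>k. if k = l then 1 else 0) n" for l n
  have xi_Rn: "xi v \<in> Rn N" for v by (simp add: xi_def topspace_Euclidean_space)
  have f_xi: "f (xi v) n = (\<Sum>l<N. v (Lift l) * F l n)" for v n
  proof -
    have "xi v = (\<Sum>l<N. v (Lift l) *\<^sub>R (\<lambda>k. if k = l then 1 else 0))"
      by (auto simp: xi_def fun_eq_iff sum_fun_apply scaleR_fun_def if_distrib cong: if_cong)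
    then have "f (xi v) = (\<Sum>l<N. v (Lift l) *\<^sub>R f (\<lambda>k. if k = l then 1 else 0))"
      by (simp only: linear_sum[OF f] linear_cmul[OF f])
    then show ?thesis by (simp add: sum_fun_apply scaleR_fun_def F_def)
  qed

  \<comment> \<open>The factor turns positive semidefiniteness into polynomial equations, and its
    entries become functions with jets along a section.\<close>
  define X where "X = {v. v (Base True) = a (pt v) \<and> v (Base False) = b (pt v) \<and> pt v \<in> S \<and>
    (\<forall>n<49. f (xi v) n = \<phi> (pt v) n) \<and>
    (\<forall>i<d. \<forall>j<d. mat (xi v) i j = (\<Sum>k<d. v (Factor i k) * v (Factor j k)))}"
  define I :: "'m coord set" where "I = range Point \<union> Lift ` {..<N} \<union> (\<lambda>(i, k). Factor i k) ` ({..<d} \<times> {..<d})"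
  define J where "J = I \<union> {Base True, Base False}"
  have "finite I" by (simp add: I_def)
  obtain \<Psi> where \<Psi>: "finite \<Psi>" "\<And>g. g \<in> \<Psi> \<Longrightarrow> real_polynomial_function g"
    "\<And>x y. (\<forall>g\<in>\<Psi>. g x > 0 \<longleftrightarrow> g y > 0) \<Longrightarrow> (x \<in> S \<longleftrightarrow> y \<in> S)"
    using semialgebraic_signs[OF S] by (elim exE conjE) (rule that; blast)
  define G1 where "G1 v = v (Base True) - a (pt v)" for v
  define G2 where "G2 v = v (Base False) - b (pt v)" for v
  define G3 where "G3 n v = (\<Sum>l<N. v (Lift l) * F l n) - a (pt v) ^ (n div 7) * b (pt v) ^ (n mod 7)" for n v
  define G4 where "G4 i j v = M0 i j + (\<Sum>l<N. v (Lift l) * M l i j)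
    - (\<Sum>k<d. v (Factor i k) * v (Factor j k))" for i j and v :: "'m coord \<Rightarrow> real"
  define \<Phi> where "\<Phi> = {G1, G2} \<union> (\<lambda>g v. g (pt v)) ` \<Psi> \<union> G3 ` {..<49} \<union> (\<lambda>(i, j). G4 i j) ` ({..<d} \<times> {..<d})"
  have mat_xi: "mat (xi v) i j = M0 i j + (\<Sum>l<N. v (Lift l) * M l i j)" for v i j
    by (simp add: mat_def xi_def)
  have X_iff: "v \<in> X \<longleftrightarrow> G1 v = 0 \<and> G2 v = 0 \<and> pt v \<in> S \<and> (\<forall>n<49. G3 n v = 0) \<and>
      (\<forall>i<d. \<forall>j<d. G4 i j v = 0)" for v
    by (simp add: X_def G1_def G2_def G3_def G4_def f_xi mat_xi \<phi>_def)
  have poly_pt: "(\<lambda>v. g (pt v)) \<in> mpoly_fun J" if "real_polynomial_function g" for g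
    unfolding pt_def by (rule mpoly_fun_mono[OF mpoly_fun_Point[OF that]]) (auto simp: J_def I_def)
  have J_mem: "Base True \<in> J" "Base False \<in> J" "\<And>l. l < N \<Longrightarrow> Lift l \<in> J"
    "\<And>i k. i < d \<Longrightarrow> k < d \<Longrightarrow> Factor i k \<in> J"
    by (auto simp: J_def I_def)
  have "finite \<Phi>" using \<Psi>(1) by (simp add: \<Phi>_def)
  have "G1 \<in> mpoly_fun J" "G2 \<in> mpoly_fun J"
    unfolding G1_def[abs_def] G2_def[abs_def]
    by (intro mpoly_fun_diff mpoly_fun.var poly_pt a b J_mem)+
  moreover have "G3 n \<in> mpoly_fun J" for n
    unfolding G3_def[abs_def]
    by (intro mpoly_fun_diff mpoly_fun_sum mpoly_fun.mult mpoly_fun.const mpoly_fun_power mpoly_fun.var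
        poly_pt a b J_mem) auto
  moreover have "G4 i j \<in> mpoly_fun J" if "i < d" "j < d" for i j
    unfolding G4_def[abs_def] using that
    by (intro mpoly_fun_diff mpoly_fun_sum mpoly_fun.add mpoly_fun.mult mpoly_fun.const mpoly_fun.var
        J_mem) auto
  ultimately have \<Phi>_J: "\<Phi> \<subseteq> mpoly_fun J" using poly_pt \<Psi>(2) by (auto simp: \<Phi>_def)
  have sign: "w \<in> X" if v: "v \<in> X" and sgn: "\<And>g. g \<in> \<Phi> \<Longrightarrow> sgn (g w) = sgn (g v)" for v w
  proof -
    have zero: "g w = 0" if "g \<in> \<Phi>" "g v = 0" for g
      using sgn[OF that(1)] that(2) by (simp add: sgn_0_0)
    have "g (pt v) > 0 \<longleftrightarrow> g (pt w) > 0" if "g \<in> \<Psi>" for g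
    proof -
      have "sgn (g (pt w)) = sgn (g (pt v))" using sgn[of "\<lambda>v. g (pt v)"] that by (auto simp: \<Phi>_def)
      then show ?thesis by (metis sgn_greater)
    qed
    then have "pt v \<in> S \<longleftrightarrow> pt w \<in> S" by (intro \<Psi>(3) ballI)
    then have "pt w \<in> S" using v by (simp add: X_iff)
    have mem: "G1 \<in> \<Phi>" "G2 \<in> \<Phi>" "\<And>n. n < 49 \<Longrightarrow> G3 n \<in> \<Phi>" "\<And>i j. i < d \<Longrightarrow> j < d \<Longrightarrow> G4 i j \<in> \<Phi>"
      by (auto simp: \<Phi>_def)
    show ?thesis unfolding X_iff
    proof (intro conjI allI impI)
      show "G1 w = 0" by (rule zero[OF mem(1)]) (use v in \<open>simp add: X_iff\<close>)
      show "G2 w = 0" by (rule zero[OF mem(2)]) (use v in \<open>simp add: X_iff\<close>)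
      show "pt w \<in> S" by fact
      show "G3 n w = 0" if "n < 49" for n
        by (rule zero[OF mem(3)[OF that]]) (use v that in \<open>simp add: X_iff\<close>)
      show "G4 i j w = 0" if "i < d" "j < d" for i j
        by (rule zero[OF mem(4)[OF that]]) (use v that in \<open>simp add: X_iff\<close>)
    qed
  qed
  have surj: "\<exists>v\<in>X. pt v = x" if "x \<in> S" for x
  proof -
    have "\<phi> x \<in> K" unfolding K_def
    proof (rule in_closure_convex_hull)
      show "y \<in> Rn 49" if "y \<in> \<phi> ` S" for y using that by (rule \<phi>_Rn)
      show "\<phi> x \<in> \<phi> ` S" using that by (rule imageI)
    qed
    then have "\<exists>\<xi>\<in>T. f \<xi> = \<phi> x" unfolding K by (elim imageE) (rule bexI, rule sym)
    then obtain \<xi> where \<xi>: "\<xi> \<in> T" "f \<xi> = \<phi> x" by (rule bexE)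
    then have "psd_matrix d (mat \<xi>)" unfolding T_iff by (rule_tac conjunct2)
    then obtain Z where Z: "\<forall>i<d. \<forall>j<d. mat \<xi> i j = (\<Sum>k<d. Z i k * Z j k)"
      by (rule psd_factorization)
    define v where "v i = (case i of Base c \<Rightarrow> if c then a x else b x | Point j \<Rightarrow> x $ j
      | Lift l \<Rightarrow> \<xi> l | Factor i k \<Rightarrow> Z i k)" for i
    have [simp]: "pt v = x" by (simp add: pt_def v_def vec_eq_iff)
    have "xi v = \<xi>" using \<xi>(1) by (auto simp: T_iff xi_def v_def fun_eq_iff topspace_Euclidean_space)
    then have "v \<in> X" using that \<xi>(2) Z by (simp add: X_def) (simp add: v_def)
    then show ?thesis by (intro bexI[of _ v]) simp_all
  qed
  \<comment> \<open>As \<open>X\<close> maps onto \<open>S\<close>, the independence of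
    \<open>a\<close> and \<open>b\<close> on \<open>S\<close> carries over to the base coordinates
    on \<open>X\<close>.\<close>
  have dense: "q v = 0" if q: "q \<in> mpoly_fun {Base True, Base False}" and van: "\<And>v. v \<in> X \<Longrightarrow> q v = 0" for q v
  proof -
    have "q (\<lambda>i. if i = Base True then a x else b x) = 0" if "x \<in> S" for x
    proof -
      obtain v where v: "v \<in> X" "pt v = x" using surj[OF \<open>x \<in> S\<close>] by (rule bexE)
      have "q (\<lambda>i. if i = Base True then a x else b x) = q v"
        by (rule mpoly_fun_cong[OF q]) (use v in \<open>auto simp: X_def\<close>)
      then show ?thesis using van[OF v(1)] by simp
    qed
    then show ?thesis using indep q by blast
  qed

  \<comment> \<open>A section through a generic point and a quadrature along it\<close>
  have "\<exists>v \<sigma>. jet_section (Base True) (Base False) J {} v \<sigma> \<and> (\<forall>\<^sub>F h in nhds 0. \<sigma> h \<in> X)"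
  proof (rule jet_section_in_set[OF \<open>finite I\<close> _ _ _ \<open>finite \<Phi>\<close>])
    show "\<Phi> \<subseteq> mpoly_fun (I \<union> {Base True, Base False})" using \<Phi>_J by (simp only: J_def)
    show "q v = 0" if "q \<in> mpoly_fun {Base True, Base False}" "\<And>v. v \<in> X \<Longrightarrow> q v = 0" for q v
      using that by (rule dense)
    show "w \<in> X" if "v \<in> X" "\<And>g. g \<in> \<Phi> \<Longrightarrow> sgn (g w) = sgn (g v)" for v w
      using that by (rule sign)
    show "\<exists>v \<sigma>. jet_section (Base True) (Base False) J {} v \<sigma> \<and> (\<forall>\<^sub>F h in nhds 0. \<sigma> h \<in> X)"
      if "jet_section (Base True) (Base False) (I \<union> {Base True, Base False}) {} v \<sigma>"
        "\<forall>\<^sub>F h in nhds 0. \<sigma> h \<in> X" for v \<sigma>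
      using that by (intro exI conjI) (simp_all only: J_def)
  qed (auto simp: I_def)
  then obtain v \<sigma> where sec: "jet_section (Base True) (Base False) J {} v \<sigma>"
    and \<sigma>X: "\<forall>\<^sub>F h in nhds 0. \<sigma> h \<in> X"
    by (elim exE conjE)
  define w where "w = (\<lambda>(i, k) h. \<sigma> h (Factor i k))"
  have w_jet: "w p \<in> jet" if "p \<in> {..<d} \<times> {..<d}" for p
    using sec that J_mem(4) by (auto simp: jet_section_def w_def)
  have fin: "finite ({..<d} \<times> {..<d})" by simp
  have B: "\<forall>\<^sub>F h in nhds 0. h \<in> {h. \<sigma> h \<in> X}" using \<sigma>X by simp
  obtain n t and l :: "nat \<Rightarrow> real" and x :: "nat \<Rightarrow> real \<times> real"
    where x: "\<forall>m<n. x m \<in> {h. \<sigma> h \<in> X}" and l_pos: "0 < (\<Sum>m<n. l m)"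
      and quad: "\<forall>\<gamma>. 0 \<le> (\<Sum>m<n. l m * (\<Sum>p\<in>{..<d}\<times>{..<d}. \<gamma> p * w p (x m))\<^sup>2)"
      and neg: "(\<Sum>m<n. l m * robinson t (x m)) < 0"
    by (rule signed_quadrature[OF fin w_jet B])
  \<comment> \<open>The weights are normalised to total 1, so that the affine combination reproduces
    the constant matrix \<open>M0\<close>.\<close>
  define r where "r m = l m / (\<Sum>m<n. l m)" for m
  have r_sum: "(\<Sum>m<n. r m) = 1" using l_pos by (simp add: r_def flip: sum_divide_distrib)
  define \<xi> where "\<xi> = (\<Sum>m<n. r m *\<^sub>R xi (\<sigma> (x m)))"
  have \<xi>_apply: "\<xi> k = (\<Sum>m<n. r m * xi (\<sigma> (x m)) k)" for k
    by (simp add: \<xi>_def sum_fun_apply scaleR_fun_def)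
  have mat_\<xi>: "mat \<xi> i j = (\<Sum>m<n. r m * mat (xi (\<sigma> (x m))) i j)" for i j
  proof -
    have "(\<Sum>m<n. r m * mat (xi (\<sigma> (x m))) i j)
        = (\<Sum>m<n. r m) * M0 i j + (\<Sum>m<n. \<Sum>k<N. r m * (xi (\<sigma> (x m)) k * M k i j))"
      by (simp add: mat_def distrib_left sum.distrib sum_distrib_left sum_distrib_right)
    also have "(\<Sum>m<n. \<Sum>k<N. r m * (xi (\<sigma> (x m)) k * M k i j)) = (\<Sum>k<N. \<xi> k * M k i j)"
      by (subst sum.swap) (simp add: \<xi>_apply sum_distrib_left sum_distrib_right mult_ac)
    finally show ?thesis by (simp add: r_sum mat_def)
  qed
  have fact: "mat (xi (\<sigma> (x m))) i j = (\<Sum>k<d. w (i, k) (x m) * w (j, k) (x m))"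
    if "m < n" "i < d" "j < d" for m i j
    using x that by (simp add: X_def w_def)
  have "psd_matrix d (mat \<xi>)"
    unfolding psd_matrix_def
  proof (intro conjI allI)
    show "sym_matrix d (mat \<xi>)"
      using M0 M by (simp add: sym_matrix_def mat_def)
    fix c :: "nat \<Rightarrow> real"
    \<comment> \<open>The quadratic form splits over the columns \<open>k\<close> of the factor;
      each column gives a weighted sum of squares of one linear combination of the functions
      \<open>w\<close>.\<close>
    have "(\<Sum>i<d. \<Sum>j<d. c i * mat \<xi> i j * c j)
        = (\<Sum>i<d. \<Sum>j<d. \<Sum>m<n. \<Sum>k<d. r m * ((c i * w (i, k) (x m)) * (c j * w (j, k) (x m))))"
      unfolding mat_\<xi> by (intro sum.cong refl) (simp add: fact sum_distrib_left sum_distrib_right mult_ac)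
    also have "\<dots> = (\<Sum>k<d. \<Sum>m<n. \<Sum>i<d. \<Sum>j<d. r m * ((c i * w (i, k) (x m)) * (c j * w (j, k) (x m))))"
    proof -
      have "(\<Sum>i<d. \<Sum>j<d. \<Sum>m<n. \<Sum>k<d. g i j m k) = (\<Sum>k<d. \<Sum>m<n. \<Sum>i<d. \<Sum>j<d. g i j m k)"
        for g :: "nat \<Rightarrow> nat \<Rightarrow> nat \<Rightarrow> nat \<Rightarrow> real"
      proof -
        have "(\<Sum>i<d. \<Sum>j<d. \<Sum>m<n. \<Sum>k<d. g i j m k) = (\<Sum>i<d. \<Sum>j<d. \<Sum>k<d. \<Sum>m<n. g i j m k)"
          by (intro sum.cong refl sum.swap)
        also have "\<dots> = (\<Sum>i<d. \<Sum>k<d. \<Sum>j<d. \<Sum>m<n. g i j m k)"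
          by (intro sum.cong refl sum.swap)
        also have "\<dots> = (\<Sum>k<d. \<Sum>i<d. \<Sum>j<d. \<Sum>m<n. g i j m k)" by (rule sum.swap)
        also have "\<dots> = (\<Sum>k<d. \<Sum>i<d. \<Sum>m<n. \<Sum>j<d. g i j m k)"
          by (intro sum.cong refl sum.swap)
        also have "\<dots> = (\<Sum>k<d. \<Sum>m<n. \<Sum>i<d. \<Sum>j<d. g i j m k)"
          by (intro sum.cong refl sum.swap)
        finally show ?thesis .
      qed
      then show ?thesis .
    qed
    also have "\<dots> = (\<Sum>k<d. (\<Sum>m<n. l m * (\<Sum>i<d. c i * w (i, k) (x m))\<^sup>2) / (\<Sum>m<n. l m))"
    proof -
      have sq: "(\<Sum>i<d. g i)\<^sup>2 = (\<Sum>i<d. \<Sum>j<d. g i * g j)" for g :: "nat \<Rightarrow> real"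
        by (simp only: power2_eq_square sum_product)
      show ?thesis
        unfolding sq by (simp only: r_def sum_divide_distrib sum_distrib_left times_divide_eq_left)
    qed
    also have "\<dots> \<ge> 0"
    proof (rule sum_nonneg)
      fix k assume "k \<in> {..<d}"
      \<comment> \<open>The coefficients select the \<open>k\<close>-th column of the
        factor.\<close>
      have "(\<Sum>p\<in>{..<d}\<times>{..<d}. (if snd p = k then c (fst p) else 0) * w p h) = (\<Sum>i<d. c i * w (i, k) h)" for h
      proof -
        have "(\<Sum>p\<in>{..<d}\<times>{..<d}. (if snd p = k then c (fst p) else 0) * w p h)
            = (\<Sum>i<d. \<Sum>j<d. if j = k then c i * w (i, j) h else 0)"
          by (subst sum.cartesian_product) (auto intro!: sum.cong)
        then show ?thesis using \<open>k \<in> {..<d}\<close> by simp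
      qed
      then have "0 \<le> (\<Sum>m<n. l m * (\<Sum>i<d. c i * w (i, k) (x m))\<^sup>2)"
        using spec[OF quad, of "\<lambda>p. if snd p = k then c (fst p) else 0"] by simp
      then show "0 \<le> (\<Sum>m<n. l m * (\<Sum>i<d. c i * w (i, k) (x m))\<^sup>2) / (\<Sum>m<n. l m)"
        using l_pos by (rule divide_nonneg_pos)
    qed
    finally show "0 \<le> (\<Sum>i<d. \<Sum>j<d. c i * mat \<xi> i j * c j)" .
  qed
  moreover have "\<xi> \<in> Rn N" using xi_Rn by (simp add: topspace_Euclidean_space \<xi>_apply)
  ultimately have f\<xi>: "f \<xi> \<in> K" unfolding K T_iff by (simp add: T_iff)

  \<comment> \<open>The separating linear functional\<close>
  have "\<exists>c. \<forall>A B. robinson t (A - v (Base True), B - v (Base False))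
      = (\<Sum>n<49. c n * (A ^ (n div 7) * B ^ (n mod 7)))"
    using bidegree6_robinson[of t "v (Base True)" "v (Base False)"]
    unfolding bidegree6_def mem_Collect_eq .
  then obtain c where c: "\<forall>A B. robinson t (A - v (Base True), B - v (Base False))
      = (\<Sum>n<49. c n * (A ^ (n div 7) * B ^ (n mod 7)))"
    by (rule exE)
  have c_\<phi>: "(\<Sum>n<49. c n * \<phi> y n) = robinson t (a y - v (Base True), b y - v (Base False))" for y
    by (simp add: \<phi>_def c[rule_format])
  have "0 \<le> (\<Sum>n<49. c n * f \<xi> n)"
  proof (rule closure_convex_hull_halfspace)
    show "y \<in> Rn 49" if "y \<in> \<phi> ` S" for y using that by (rule \<phi>_Rn)
    show "0 \<le> (\<Sum>n<49. c n * y n)" if y: "y \<in> \<phi> ` S" for y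
    proof -
      obtain z where "y = \<phi> z" using y by (rule imageE)
      then show ?thesis by (simp only: c_\<phi> robinson_nonneg)
    qed
    show "f \<xi> \<in> Euclidean_space 49 closure_of (convex hull (\<phi> ` S))"
      using f\<xi> by (simp only: K_def)
  qed
  also have "(\<Sum>n<49. c n * f \<xi> n) = (\<Sum>m<n. r m * robinson t (x m))"
  proof -
    have "f \<xi> k = (\<Sum>m<n. r m * f (xi (\<sigma> (x m))) k)" for k
      unfolding \<xi>_def linear_sum[OF f] linear_cmul[OF f] by (simp add: sum_fun_apply scaleR_fun_def)
    then have "(\<Sum>k<49. c k * f \<xi> k) = (\<Sum>k<49. \<Sum>m<n. r m * (c k * f (xi (\<sigma> (x m))) k))"
      by (simp add: sum_distrib_left mult_ac)
    also have "\<dots> = (\<Sum>m<n. \<Sum>k<49. r m * (c k * f (xi (\<sigma> (x m))) k))" by (rule sum.swap)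
    also have "\<dots> = (\<Sum>m<n. r m * robinson t (x m))"
    proof (intro sum.cong refl)
      fix m assume "m \<in> {..<n}"
      \<comment> \<open>On \<open>X\<close> the lift maps to \<open>\<phi>\<close> and the base
        coordinates are the values of \<open>a\<close> and \<open>b\<close>. The section moves these
        by exactly \<open>x m\<close>, so the centred Robinson form takes the value
        \<open>robinson t (x m)\<close>.\<close>
      then have "\<sigma> (x m) \<in> X" using x by simp
      then have "(\<Sum>k<49. c k * f (xi (\<sigma> (x m))) k)
          = robinson t (\<sigma> (x m) (Base True) - v (Base True), \<sigma> (x m) (Base False) - v (Base False))"
        using c_\<phi>[of "pt (\<sigma> (x m))"] by (simp add: X_def)
      also have "\<dots> = robinson t (x m)"
      proof -
        have "\<sigma> h (Base True) = v (Base True) + fst h" "\<sigma> h (Base False) = v (Base False) + snd h" for h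
          using sec unfolding jet_section_def by blast+
        then show ?thesis by simp
      qed
      finally show "(\<Sum>k<49. r m * (c k * f (xi (\<sigma> (x m))) k)) = r m * robinson t (x m)"
        by (simp flip: sum_distrib_left)
    qed
    finally show ?thesis .
  qed
  also have "\<dots> = (\<Sum>m<n. l m * robinson t (x m)) / (\<Sum>m<n. l m)"
    by (simp add: r_def sum_divide_distrib)
  also have "\<dots> < 0" using neg l_pos by (rule divide_neg_pos)
  finally show False by simp
qed

theorem theorem4p23:
  fixes S :: "(real ^ 'm) set"
  assumes "semialgebraic S"
    and "semialg_dim S \<ge> 2"
  shows "\<exists>k\<ge>1. \<exists>\<phi>. polynomial_map_on S k \<phi> \<and>
    \<not> spectrahedral_shadow k (Euclidean_space k closure_of (convex hull (\<phi> ` S)))"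
proof -
  obtain a b where a: "real_polynomial_function a" and b: "real_polynomial_function b"
    and indep: "\<forall>q\<in>mpoly_fun {Base True :: 'm coord, Base False}.
      (\<forall>x\<in>S. q (\<lambda>i. if i = Base True then a x else b x) = 0) \<longrightarrow> (\<forall>v. q v = 0)"
    by (rule independent_pair[of S "Base True :: 'm coord" "Base False"]) (simp_all add: assms(2))
  define \<phi> where "\<phi> x n = (if n < 49 then a x ^ (n div 7) * b x ^ (n mod 7) else 0)" for x and n :: nat
  have "polynomial_map_on S 49 \<phi>"
    unfolding polynomial_map_on_def
  proof (intro exI[of _ \<phi>] conjI allI impI ballI)
    show "\<phi> x \<in> Rn 49" for x by (simp add: \<phi>_def topspace_Euclidean_space)
    show "real_polynomial_function (\<lambda>x. \<phi> x n)" if "n < 49" for n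
      using that a b by (simp add: \<phi>_def real_polynomial_function.intros(4) real_polynomial_function_power)
  qed simp
  moreover have "\<not> spectrahedral_shadow 49 (Euclidean_space 49 closure_of (convex hull (\<phi> ` S)))"
    using not_shadow_monomial_map[OF assms(1) a b indep] by (simp add: \<phi>_def[abs_def])
  ultimately show ?thesis by (intro exI[of _ 49] exI[of _ \<phi>] conjI) simp_all
qed

end
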